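(* Let $\omega\in\mathbb{R}$, $\lambda\in\mathbb{R}\setminus\{0\}$. In the right regular co-space $(F_\lambda(ISO_\omega(2)),\prec,U_\lambda(\mathfrak{iso}_\omega(2)))$ the generators act on every $f\in F_\lambda(ISO_\omega(2))$ by $$f\prec J=\partial_\varphi f,$$ $$f\prec P_1=\frac{2\lambda\,\partial_{a_1}e^{\lambda\partial_{a_2}}\mathrm{C}_\omega(\bar\varphi)+\bigl(\omega\lambda^2\partial_{a_1}^2e^{\lambda\partial_{a_2}}-2\sinh(\lambda\partial_{a_2})\bigr)\mathrm{S}_\omega(\bar\varphi)}{2\lambda\cosh(\lambda\partial_{a_2})+\omega\lambda^3\partial_{a_1}^2e^{\lambda\partial_{a_2}}+\bigl(2\lambda\sinh(\lambda\partial_{a_2})-\omega\lambda^3\partial_{a_1}^2e^{\lambda\partial_{a_2}}\bigr)\mathrm{C}_\omega(\bar\varphi)+2\omega\lambda^2\partial_{a_1}e^{\lambda\partial_{a_2}}\mathrm{S}_\omega(\bar\varphi)}\,f,$$ $$f\prec P_2=\frac1\lambda\ln\Bigl[\cosh(\lambda\partial_{a_2})+\tfrac12\omega\lambda^2\partial_{a_1}^2e^{\lambda\partial_{a_2}}+\bigl(\sinh(\lambda\partial_{a_2})-\tfrac12\omega\lambda^2\partial_{a_1}^2e^{\lambda\partial_{a_2}}\bigr)\mathrm{C}_\omega(\bar\varphi)+\omega\lambda\,\partial_{a_1}e^{\lambda\partial_{a_2}}\mathrm{S}_\omega(\bar\varphi)\Bigr]f.$$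
   Context: The functions $\mathrm{C}_\omega,\mathrm{S}_\omega$ are $\mathrm{C}_\omega(x)=\frac{e^{\sqrt{-\omega}x}+e^{-\sqrt{-\omega}x}}{2}$, $\mathrm{S}_\omega(x)=\frac{e^{\sqrt{-\omega}x}-e^{-\sqrt{-\omega}x}}{2\sqrt{-\omega}}$ for $\omega\neq0$, and $\mathrm{C}_0(x)=1$, $\mathrm{S}_0(x)=x$. The algebra $H=U_\lambda(\mathfrak{iso}_\omega(2))$ is the unital associative complex algebra generated by $J$ and the commutative subalgebra $\mathcal{L}=\mathbb{C}[P_1,P_2,e^{\pm\lambda P_2}]$ of functions on $\mathbb{R}^2$ (with $P_i(\alpha_1,\alpha_2)=\alpha_i$), subject to $[l,J]=\hat J(l)$ for $l\in\mathcal{L}$, where $\hat J$ is the derivation $$\hat J=-\Bigl[\frac{1-e^{-2\lambda P_2}}{2\lambda}+\frac12\lambda\omega P_1^2\Bigr]\frac{\partial}{\partial P_1}+\omega P_1\frac{\partial}{\partial P_2}.$$ As a vector space $H=\bigoplus_{m\ge0}J^m\mathcal{L}$. $F_\lambda(ISO_\omega(2))$ is the dual Hopf algebra, generated by $\varphi,a_1,a_2$; its elements are written in the normal ordering $\varphi^qa_1^ra_2^s$, polynomially in $a_1,a_2$ with coefficients formal power series in $\varphi$ placed on the left. The pairing with $H$ is determined by $\langle J^mP_1^nP_2^p,\varphi^qa_1^ra_2^s\rangle=m!\,n!\,p!\,\delta_m^q\delta_n^r\delta_p^s$; for general $l\in\mathcal{L}$ it is $\langle J^ml,\varphi^qa_1^ra_2^s\rangle=m!\,\delta_m^q\,(\partial_1^r\partial_2^sl)(0,0)$.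 The right regular action is defined by $\langle h',f\prec h\rangle=\langle hh',f\rangle$ for $h,h'\in H$. Operators act on normally ordered expressions: $\bar\varphi(\varphi^qa_1^ra_2^s)=\varphi^{q+1}a_1^ra_2^s$, and $\partial_\varphi,\partial_{a_1},\partial_{a_2}$ are the formal partial derivatives, e.g. $\partial_{a_1}(\varphi^qa_1^ra_2^s)=r\varphi^qa_1^{r-1}a_2^s$. The operators $\bar\varphi,\partial_{a_1},\partial_{a_2}$ commute, and the quotient and logarithm above are understood as formal power series in these commuting operators. *)

theory Defs
  imports "HOL-Analysis.Analysis" "HOL-Computational_Algebra.Computational_Algebra"
    "HOL-Algebra.Ring"
begin

unbundle no vec_syntax

section \<open>The commutative algebra $\mathcal{L}$ and the derivation $\hat J$\<close>

inductive_set Lset :: "real \<Rightarrow> (real \<times> real \<Rightarrow> complex) set" for lam :: real where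
  const: "(\<lambda>p. c) \<in> Lset lam"
| P1: "(\<lambda>p. of_real (fst p)) \<in> Lset lam"
| P2: "(\<lambda>p. of_real (snd p)) \<in> Lset lam"
| exp_pos: "(\<lambda>p. exp (of_real (lam * snd p))) \<in> Lset lam"
| exp_neg: "(\<lambda>p. exp (of_real (- lam * snd p))) \<in> Lset lam"
| add: "l \<in> Lset lam \<Longrightarrow> l' \<in> Lset lam \<Longrightarrow> (\<lambda>p. l p + l' p) \<in> Lset lam"
| mult: "l \<in> Lset lam \<Longrightarrow> l' \<in> Lset lam \<Longrightarrow> (\<lambda>p. l p * l' p) \<in> Lset lam"

definition Lring :: "real \<Rightarrow> (real \<times> real \<Rightarrow> complex) ring" where
  "Lring lam = \<lparr>carrier = Lset lam,
     mult = (\<lambda>l l' p. l p * l' p), one = (\<lambda>p. 1),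
     zero = (\<lambda>p. 0), add = (\<lambda>l l' p. l p + l' p)\<rparr>"

definition pd1 :: "(real \<times> real \<Rightarrow> complex) \<Rightarrow> real \<times> real \<Rightarrow> complex" where
  "pd1 l = (\<lambda>(x, y). vector_derivative (\<lambda>t. l (t, y)) (at x))"

definition pd2 :: "(real \<times> real \<Rightarrow> complex) \<Rightarrow> real \<times> real \<Rightarrow> complex" where
  "pd2 l = (\<lambda>(x, y). vector_derivative (\<lambda>t. l (x, t)) (at y))"

definition Jhat ::
  "real \<Rightarrow> real \<Rightarrow> (real \<times> real \<Rightarrow> complex) \<Rightarrow> real \<times> real \<Rightarrow> complex" where
  "Jhat lam om l = (\<lambda>p.
     - of_real ((1 - exp (- 2 * lam * snd p)) / (2 * lam) + 1 / 2 * lam * om * (fst p)\<^sup>2) * pd1 l p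
     + of_real (om * fst p) * pd2 l p)"

section \<open>The algebra $U_\lambda(\mathfrak{iso}_\omega(2))$\<close>

text \<open>
  A normal form of h is a finitely supported sequence l of elements of \<open>\<L>\<close>
  with h equal to the sum of the J^m l_m, where emb embeds \<open>\<L>\<close> into H.
\<close>

definition normal_form ::
  "('h, 'm) ring_scheme \<Rightarrow> real \<Rightarrow> 'h \<Rightarrow> ((real \<times> real \<Rightarrow> complex) \<Rightarrow> 'h)
    \<Rightarrow> 'h \<Rightarrow> (nat \<Rightarrow> real \<times> real \<Rightarrow> complex) \<Rightarrow> bool" where
  "normal_form H lam J emb h l \<longleftrightarrow>
     (\<forall>m. l m \<in> Lset lam) \<and> finite {m. l m \<noteq> (\<lambda>p. 0)} \<and>
     h = (\<Oplus>\<^bsub>H\<^esub> m \<in> {m. l m \<noteq> (\<lambda>p. 0)}. J [^]\<^bsub>H\<^esub> m \<otimes>\<^bsub>H\<^esub> emb (l m))"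

text \<open>
  The ring H with generator J and subalgebra emb ` \<open>\<L>\<close>. The scalar c acts on H as
  multiplication by emb of the constant function c; by the commutation relation and since
  Jhat kills constants, this is central, so H is a complex algebra.
  The relation and the decomposition into the J^m \<open>\<L>\<close> determine H up to isomorphism.
\<close>

locale U_iso2 = ring H for H :: "('h, 'm) ring_scheme" (structure) +
  fixes lam om :: real
    and J :: 'h
    and emb :: "(real \<times> real \<Rightarrow> complex) \<Rightarrow> 'h"
  assumes J_closed: "J \<in> carrier H"
    and emb_hom: "emb \<in> ring_hom (Lring lam) H"
    and commutation: "l \<in> Lset lam \<Longrightarrow> emb l \<otimes> J \<ominus> J \<otimes> emb l = emb (Jhat lam om l)"
    and decomposition: "h \<in> carrier H \<Longrightarrow> \<exists>!l. normal_form H lam J emb h l"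

definition coords ::
  "('h, 'm) ring_scheme \<Rightarrow> real \<Rightarrow> 'h \<Rightarrow> ((real \<times> real \<Rightarrow> complex) \<Rightarrow> 'h)
    \<Rightarrow> 'h \<Rightarrow> nat \<Rightarrow> real \<times> real \<Rightarrow> complex" where
  "coords H lam J emb h = (THE l. normal_form H lam J emb h l)"

section \<open>The space $F_\lambda(ISO_\omega(2))$, the pairing and the right regular action\<close>

text \<open>
  An element of F is stored through its normal ordering: the outer polynomial variable is a2,
  the inner one is a1, and the coefficients are power series in phi, so that the coefficient of
  phi^q a1^r a2^s in f is coeff (coeff f s) r $ q. Only the vector space structure of the type is
  meaningful: its commutative product is not the product of F.
\<close>

type_synonym F = "complex fps poly poly"

definition d_phi :: "F \<Rightarrow> F" where
  "d_phi = map_poly (map_poly fps_deriv)"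

definition d_a1 :: "F \<Rightarrow> F" where
  "d_a1 = map_poly pderiv"

definition d_a2 :: "F \<Rightarrow> F" where
  "d_a2 = pderiv"

definition pairing ::
  "('h, 'm) ring_scheme \<Rightarrow> real \<Rightarrow> 'h \<Rightarrow> ((real \<times> real \<Rightarrow> complex) \<Rightarrow> 'h)
    \<Rightarrow> 'h \<Rightarrow> F \<Rightarrow> complex" where
  "pairing H lam J emb h f =
     (let l = coords H lam J emb h in
      \<Sum>m \<in> {m. l m \<noteq> (\<lambda>p. 0)}. \<Sum>s \<le> degree f. \<Sum>r \<le> degree (coeff f s).
        (coeff (coeff f s) r $ m) * (fact m * (pd1 ^^ r) ((pd2 ^^ s) (l m)) (0, 0)))"

definition right_regular ::
  "('h, 'm) ring_scheme \<Rightarrow> real \<Rightarrow> 'h \<Rightarrow> ((real \<times> real \<Rightarrow> complex) \<Rightarrow> 'h)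
    \<Rightarrow> F \<Rightarrow> 'h \<Rightarrow> F" where
  "right_regular H lam J emb f h =
     (THE g. \<forall>h' \<in> carrier H. pairing H lam J emb h' g = pairing H lam J emb (h \<otimes>\<^bsub>H\<^esub> h') f)"

section \<open>Formal power series in the operators\<close>

text \<open>
  Power series in three commuting variables: innermost the multiplication by phi, then the
  derivative in a1, outermost the derivative in a2.
\<close>

type_synonym series3 = "complex fps fps fps"

definition scal :: "complex \<Rightarrow> series3" where
  "scal c = fps_const (fps_const (fps_const c))"

definition Phi :: series3 where
  "Phi = fps_const (fps_const fps_X)"

definition D1 :: series3 where
  "D1 = fps_const fps_X"

definition D2 :: series3 where
  "D2 = fps_X"

text \<open>
  Substitution of a series u without constant term into a univariate series a. The library's
  composition does not apply, since u may have a nonzero coefficient at degree 0 in the outermost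
  variable. The truncation is exact: all terms of u^k have total degree at least k.
\<close>

definition subst3 :: "complex fps \<Rightarrow> series3 \<Rightarrow> series3" where
  "subst3 a u = Abs_fps (\<lambda>s. Abs_fps (\<lambda>r. Abs_fps (\<lambda>q.
     \<Sum>k \<le> q + r + s. a $ k * (u ^ k $ s $ r $ q))))"

definition exp3 :: "series3 \<Rightarrow> series3" where
  "exp3 u = subst3 (fps_exp 1) u"

definition cosh3 :: "series3 \<Rightarrow> series3" where
  "cosh3 u = scal (1 / 2) * (exp3 u + exp3 (- u))"

definition sinh3 :: "series3 \<Rightarrow> series3" where
  "sinh3 u = scal (1 / 2) * (exp3 u - exp3 (- u))"

text \<open>The logarithm of a series with constant term 1.\<close>

definition ln3 :: "series3 \<Rightarrow> series3" where
  "ln3 u = subst3 (fps_ln 1) (u - 1)"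

definition C_om :: "real \<Rightarrow> complex fps" where
  "C_om om = (if om = 0 then 1 else
     (let k = csqrt (of_real (- om)) in fps_const (1 / 2) * (fps_exp k + fps_exp (- k))))"

definition S_om :: "real \<Rightarrow> complex fps" where
  "S_om om = (if om = 0 then fps_X else
     (let k = csqrt (of_real (- om)) in fps_const (1 / (2 * k)) * (fps_exp k - fps_exp (- k))))"

text \<open>
  The operator obtained from a series; the sum over the powers of phi is the multiplication by
  the coefficient T $ j $ i. The index set is finite, since the derivatives are nilpotent on f.
\<close>

definition act :: "series3 \<Rightarrow> F \<Rightarrow> F" where
  "act T f = (\<Sum>(i, j) \<in> {(i, j). (d_a1 ^^ i) ((d_a2 ^^ j) f) \<noteq> 0}.
     smult [:T $ j $ i:] ((d_a1 ^^ i) ((d_a2 ^^ j) f)))"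

text \<open>
  The inverse of the library is the true inverse of every series with nonzero constant term.
\<close>

lemma series3_inverse:
  fixes T :: series3
  assumes "T $ 0 $ 0 $ 0 \<noteq> 0"
  shows "T * inverse T = 1"
proof -
  have "T $ 0 $ 0 * inverse (T $ 0 $ 0) = 1"
    using assms inverse_mult_eq_1' by blast
  hence "T $ 0 * inverse (T $ 0) = 1"
    unfolding fps_inverse_def[of "T $ 0"] by (rule fps_right_inverse)
  thus ?thesis
    unfolding fps_inverse_def[of T] by (rule fps_right_inverse)
qed

section \<open>Existence of the algebra\<close>

text \<open>
  The algebra is realised on sequences in \<open>\<L>\<close>, thought of as formal series in t with
  coefficients in \<open>\<L>\<close>: J acts as t - \<open>Jhat\<close> and \<open>\<L>\<close> by multiplication.
\<close>

lemma Lset_zero: "(\<lambda>p. 0) \<in> Lset lam" by (rule Lset.const)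

lemma Lset_uminus: "l \<in> Lset lam \<Longrightarrow> (\<lambda>p. - l p) \<in> Lset lam"
  using Lset.mult[OF Lset.const[where c = "-1"], of l] by simp

lemma Lset_diff: "l \<in> Lset lam \<Longrightarrow> l' \<in> Lset lam \<Longrightarrow> (\<lambda>p. l p - l' p) \<in> Lset lam"
  using Lset.add[OF _ Lset_uminus, of l lam l'] by simp

lemma Lset_sum: "(\<And>i. i \<in> I \<Longrightarrow> l i \<in> Lset lam) \<Longrightarrow> (\<lambda>p. \<Sum>i\<in>I. l i p) \<in> Lset lam"
  by (induction I rule: infinite_finite_induct) (auto intro: Lset.add Lset_zero)

lemma exp_vector_derivative:
  "((\<lambda>t. exp (of_real (k * t)) :: complex) has_vector_derivative
     of_real k * exp (of_real (k * y))) (at y)"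
proof -
  have "((\<lambda>z. exp (of_real k * z)) has_field_derivative
      of_real k * exp (of_real k * of_real y :: complex)) (at (of_real y))"
    by (auto intro!: derivative_eq_intros)
  from has_vector_derivative_real_field[OF this] show ?thesis by simp
qed

lemma Lset_deriv:
  assumes "l \<in> Lset lam"
  shows "(\<exists>a \<in> Lset lam. \<forall>x y. ((\<lambda>t. l (t, y)) has_vector_derivative a (x, y)) (at x)) \<and>
    (\<exists>b \<in> Lset lam. \<forall>x y. ((\<lambda>t. l (x, t)) has_vector_derivative b (x, y)) (at y))"
  using assms
proof induction
  case (const c)
  then show ?case by (auto intro!: bexI[OF _ Lset_zero])
next
  case P1
  then show ?case
    by (rule conjI, rule bexI[OF _ Lset.const[where c = 1]], force intro!: derivative_eq_intros,
        rule bexI[OF _ Lset.const[where c = 0]]) (force intro!: derivative_eq_intros)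
next
  case P2
  then show ?case
    by (rule conjI, rule bexI[OF _ Lset.const[where c = 0]], force intro!: derivative_eq_intros,
        rule bexI[OF _ Lset.const[where c = 1]]) (force intro!: derivative_eq_intros)
next
  case exp_pos
  have *: "((\<lambda>t. exp (of_real (lam * t)) :: complex) has_vector_derivative
      of_real lam * exp (of_real (lam * y))) (at y)" for y
    using exp_vector_derivative[of "lam" y] by simp
  show ?case
    by (rule conjI, rule bexI[OF _ Lset_zero], simp,
        rule bexI[OF _ Lset.mult[OF Lset.const[where c = "of_real lam"] Lset.exp_pos]])
       (intro allI, simp only: snd_conv *)
next
  case exp_neg
  have *: "((\<lambda>t. exp (of_real (- lam * t)) :: complex) has_vector_derivative
      of_real (- lam) * exp (of_real (- lam * y))) (at y)" for y
    using exp_vector_derivative[of "- lam" y] by simp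
  show ?case
    by (rule conjI, rule bexI[OF _ Lset_zero], simp,
        rule bexI[OF _ Lset.mult[OF Lset.const[where c = "of_real (- lam)"] Lset.exp_neg]])
       (intro allI, simp only: snd_conv *)
next
  case (add l l')
  from add.IH obtain a b a' b' where *: "a \<in> Lset lam" "b \<in> Lset lam" "a' \<in> Lset lam" "b' \<in> Lset lam"
    "\<And>x y. ((\<lambda>t. l (t, y)) has_vector_derivative a (x, y)) (at x)"
    "\<And>x y. ((\<lambda>t. l (x, t)) has_vector_derivative b (x, y)) (at y)"
    "\<And>x y. ((\<lambda>t. l' (t, y)) has_vector_derivative a' (x, y)) (at x)"
    "\<And>x y. ((\<lambda>t. l' (x, t)) has_vector_derivative b' (x, y)) (at y)" by blast
  show ?case
    by (rule conjI, rule bexI[OF _ Lset.add[OF *(1,3)]])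
       (use * in \<open>auto intro!: has_vector_derivative_add bexI[OF _ Lset.add[OF *(2,4)]]\<close>)
next
  case (mult l l')
  from mult.IH obtain a b a' b' where *: "a \<in> Lset lam" "b \<in> Lset lam" "a' \<in> Lset lam" "b' \<in> Lset lam"
    "\<And>x y. ((\<lambda>t. l (t, y)) has_vector_derivative a (x, y)) (at x)"
    "\<And>x y. ((\<lambda>t. l (x, t)) has_vector_derivative b (x, y)) (at y)"
    "\<And>x y. ((\<lambda>t. l' (t, y)) has_vector_derivative a' (x, y)) (at x)"
    "\<And>x y. ((\<lambda>t. l' (x, t)) has_vector_derivative b' (x, y)) (at y)" by blast
  show ?case
    by (rule conjI, rule bexI[OF _ Lset.add[OF Lset.mult[OF mult.hyps(1) *(3)] Lset.mult[OF *(1) mult.hyps(2)]]])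
       (use * in \<open>auto intro!: has_vector_derivative_mult
         bexI[OF _ Lset.add[OF Lset.mult[OF mult.hyps(1) *(4)] Lset.mult[OF *(2) mult.hyps(2)]]]\<close>)
qed

lemma pd_has_derivative:
  assumes "l \<in> Lset lam"
  shows "((\<lambda>t. l (t, y)) has_vector_derivative pd1 l (x, y)) (at x)"
    and "((\<lambda>t. l (x, t)) has_vector_derivative pd2 l (x, y)) (at y)"
  using Lset_deriv[OF assms] unfolding pd1_def pd2_def
  by (auto dest!: vector_derivative_at simp: vector_derivative_works[symmetric])
     (metis differentiableI_vector)+

lemma pd_closed:
  assumes "l \<in> Lset lam"
  shows "pd1 l \<in> Lset lam" and "pd2 l \<in> Lset lam"
proof -
  from Lset_deriv[OF assms] obtain a b where *: "a \<in> Lset lam" "b \<in> Lset lam"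
    "\<And>x y. ((\<lambda>t. l (t, y)) has_vector_derivative a (x, y)) (at x)"
    "\<And>x y. ((\<lambda>t. l (x, t)) has_vector_derivative b (x, y)) (at y)" by blast
  have "pd1 l = a" "pd2 l = b"
    using * by (auto simp: pd1_def pd2_def vector_derivative_at)
  with * show "pd1 l \<in> Lset lam" "pd2 l \<in> Lset lam" by auto
qed

lemma pd_add:
  assumes "l \<in> Lset lam" "l' \<in> Lset lam"
  shows "pd1 (\<lambda>p. l p + l' p) p = pd1 l p + pd1 l' p"
    and "pd2 (\<lambda>p. l p + l' p) p = pd2 l p + pd2 l' p"
  unfolding pd1_def[of "\<lambda>p. l p + l' p"] pd2_def[of "\<lambda>p. l p + l' p"]
  by (auto split: prod.splits intro!: vector_derivative_at has_vector_derivative_add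
      pd_has_derivative assms)

lemma pd_mult:
  assumes "l \<in> Lset lam" "l' \<in> Lset lam"
  shows "pd1 (\<lambda>p. l p * l' p) p = l p * pd1 l' p + pd1 l p * l' p"
    and "pd2 (\<lambda>p. l p * l' p) p = l p * pd2 l' p + pd2 l p * l' p"
  unfolding pd1_def[of "\<lambda>p. l p * l' p"] pd2_def[of "\<lambda>p. l p * l' p"]
  by (auto split: prod.splits intro!: vector_derivative_at has_vector_derivative_mult
      pd_has_derivative assms)

lemma Jhat_add:
  assumes "l \<in> Lset lam" "l' \<in> Lset lam"
  shows "Jhat lam om (\<lambda>p. l p + l' p) p = Jhat lam om l p + Jhat lam om l' p"
proof -
  have *: "- c * (a + a') + d * (b + b') = (- c * a + d * b) + (- c * a' + d * b')"
    for a a' b b' c d :: complex by (simp add: algebra_simps)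
  show ?thesis unfolding Jhat_def pd_add[OF assms] by (rule *)
qed

lemma Jhat_mult:
  assumes "l \<in> Lset lam" "l' \<in> Lset lam"
  shows "Jhat lam om (\<lambda>p. l p * l' p) p = l p * Jhat lam om l' p + Jhat lam om l p * l' p"
proof -
  have *: "- c * (l * a' + a * l') + d * (l * b' + b * l') = l * (- c * a' + d * b') + (- c * a + d * b) * l'"
    for a a' b b' c d l l' :: complex by (simp add: algebra_simps)
  show ?thesis unfolding Jhat_def pd_mult[OF assms] by (rule *)
qed

lemma Jhat_closed:
  assumes "l \<in> Lset lam"
  shows "Jhat lam om l \<in> Lset lam"
proof -
  let ?e = "\<lambda>p. exp (of_real (- lam * snd p)) :: complex"
  have e: "of_real (exp (- 2 * lam * snd p)) = ?e p * ?e p" for p :: "real \<times> real"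
    by (simp add: mult.assoc flip: exp_add exp_of_real)
  have "(\<lambda>p. (- 1) * ((of_real (1 / (2 * lam)) * (1 - ?e p * ?e p)
          + of_real (1 / 2 * lam * om) * (of_real (fst p) * of_real (fst p))) * pd1 l p)
        + (of_real om * of_real (fst p)) * pd2 l p) \<in> Lset lam"
    by (intro Lset.add Lset.mult Lset_diff Lset.const Lset.P1 Lset.exp_neg pd_closed assms)
  also have "(\<lambda>p. (- 1) * ((of_real (1 / (2 * lam)) * (1 - ?e p * ?e p)
          + of_real (1 / 2 * lam * om) * (of_real (fst p) * of_real (fst p))) * pd1 l p)
        + (of_real om * of_real (fst p)) * pd2 l p) = Jhat lam om l"
    unfolding Jhat_def e of_real_add of_real_diff of_real_divide of_real_mult of_real_power of_real_1
    by (simp only: e of_real_mult[symmetric]) (simp add: fun_eq_iff power2_eq_square ring_distribs diff_divide_distrib)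
  finally show ?thesis .
qed


lemma Jhat_const: "Jhat lam om (\<lambda>p. c) p = 0"
  by (simp add: Jhat_def pd1_def pd2_def split: prod.splits)

definition Mset :: "real \<Rightarrow> (nat \<Rightarrow> real \<times> real \<Rightarrow> complex) set" where
  "Mset lam = {c. \<forall>m. c m \<in> Lset lam}"

definition opJ where
  "opJ lam om = (\<lambda>c \<in> Mset lam. \<lambda>m p. (if m = 0 then 0 else c (m - 1) p) - Jhat lam om (c m) p)"

definition opL where
  "opL lam l = (\<lambda>c \<in> Mset lam. \<lambda>(m::nat) p. l p * c m p :: complex)"

definition op_add where
  "op_add lam T U = (\<lambda>c \<in> Mset lam. \<lambda>m p. T c m p + U c m p :: complex)"

definition op_mult where
  "op_mult lam T U = (\<lambda>c \<in> Mset lam. T (U c))"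

inductive_set Kset for lam om :: real where
  J: "opJ lam om \<in> Kset lam om"
| L: "l \<in> Lset lam \<Longrightarrow> opL lam l \<in> Kset lam om"
| add: "T \<in> Kset lam om \<Longrightarrow> U \<in> Kset lam om \<Longrightarrow> op_add lam T U \<in> Kset lam om"
| mult: "T \<in> Kset lam om \<Longrightarrow> U \<in> Kset lam om \<Longrightarrow> op_mult lam T U \<in> Kset lam om"

definition Hmodel where
  "Hmodel lam om = \<lparr>carrier = Kset lam om, mult = op_mult lam, one = opL lam (\<lambda>p. 1),
     zero = opL lam (\<lambda>p. 0), add = op_add lam\<rparr>"

lemma Mset_add: "c \<in> Mset lam \<Longrightarrow> d \<in> Mset lam \<Longrightarrow> (\<lambda>m p. c m p + d m p) \<in> Mset lam"
  by (auto simp: Mset_def intro: Lset.add)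

lemma Kset_props:
  assumes "T \<in> Kset lam om"
  shows "T \<in> extensional (Mset lam) \<and> (\<forall>c \<in> Mset lam. T c \<in> Mset lam) \<and>
    (\<forall>c \<in> Mset lam. \<forall>d \<in> Mset lam. T (\<lambda>m p. c m p + d m p) = (\<lambda>m p. T c m p + T d m p))"
  using assms
proof induction
  case J
  have "(\<lambda>p. (if m = 0 then 0 else c (m - 1) p) - Jhat lam om (c m) p) \<in> Lset lam"
    if "c \<in> Mset lam" for c m
    using that by (cases "m = 0") (auto simp: Mset_def intro!: Lset_diff Lset_zero Jhat_closed
        Lset_uminus)
  then show ?case
    by (auto simp: opJ_def Mset_add fun_eq_iff Jhat_add Mset_def)
       (auto simp: Jhat_add Mset_def Lset.add fun_eq_iff extensional_def)
next
  case (L l)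
  then show ?case
    by (auto simp: opL_def Mset_add fun_eq_iff algebra_simps) (auto simp: Mset_def extensional_def intro: Lset.mult)
next
  case (add T U)
  then show ?case
    by (auto simp: op_add_def Mset_add fun_eq_iff algebra_simps extensional_def)
next
  case (mult T U)
  then show ?case
    by (auto simp: op_mult_def Mset_add extensional_def)
qed

lemmas Kset_ext = Kset_props[THEN conjunct1]
lemma Kset_closed: "T \<in> Kset lam om \<Longrightarrow> c \<in> Mset lam \<Longrightarrow> T c \<in> Mset lam"
  using Kset_props by blast
lemma Kset_additive: "T \<in> Kset lam om \<Longrightarrow> c \<in> Mset lam \<Longrightarrow> d \<in> Mset lam \<Longrightarrow>
   T (\<lambda>m p. c m p + d m p) = (\<lambda>m p. T c m p + T d m p)"
  using Kset_props by blast

lemma Kset_eqI: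
  assumes "T \<in> Kset lam om" "U \<in> Kset lam om" "\<And>c m p. c \<in> Mset lam \<Longrightarrow> T c m p = U c m p"
  shows "T = U"
  using assms by (intro extensionalityI[OF Kset_ext Kset_ext]) (auto simp: fun_eq_iff)

lemma opL_apply: "c \<in> Mset lam \<Longrightarrow> opL lam l c m p = l p * c m p" by (simp add: opL_def)
lemma opL_one: "c \<in> Mset lam \<Longrightarrow> opL lam (\<lambda>p. 1) c = c" by (simp add: opL_def)
lemma op_add_apply: "c \<in> Mset lam \<Longrightarrow> op_add lam T U c m p = T c m p + U c m p" by (simp add: op_add_def)
lemma op_add_eq: "c \<in> Mset lam \<Longrightarrow> op_add lam T U c = (\<lambda>m p. T c m p + U c m p)" by (simp add: op_add_def)
lemma op_mult_apply: "c \<in> Mset lam \<Longrightarrow> op_mult lam T U c = T (U c)" by (simp add: op_mult_def)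

lemma Hmodel_ring: "ring (Hmodel lam om)"
proof (rule ringI)
  note ap = opL_one opL_apply op_add_apply op_mult_apply Kset_closed Kset_additive
  note K = Kset.intros Lset_zero Lset.const
  show "abelian_group (Hmodel lam om)"
  proof (rule abelian_groupI)
    fix T assume "T \<in> carrier (Hmodel lam om)"
    hence T: "T \<in> Kset lam om" by (simp add: Hmodel_def)
    have "op_add lam (op_mult lam (opL lam (\<lambda>p. - 1)) T) T = opL lam (\<lambda>p. 0)"
      by (rule Kset_eqI[of _ lam om]) (use T in \<open>auto simp: ap intro!: K\<close>)
    thus "\<exists>U\<in>carrier (Hmodel lam om). U \<oplus>\<^bsub>Hmodel lam om\<^esub> T = \<zero>\<^bsub>Hmodel lam om\<^esub>"
      using T by (auto simp: Hmodel_def intro!: bexI[of _ "op_mult lam (opL lam (\<lambda>p. - 1)) T"] K)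
  qed (auto simp: Hmodel_def ap intro!: K Kset_eqI[of _ lam om])
  show "Group.monoid (Hmodel lam om)"
    by (rule monoidI) (auto simp: Hmodel_def ap intro!: K Kset_eqI[of _ lam om])
qed (auto simp: Hmodel_def op_add_eq op_mult_apply Kset_closed Kset_additive Mset_add
    intro!: Kset.intros Kset_eqI[of _ lam om])


inductive_set Aset for H lam J emb where
  base: "l \<in> Lset lam \<Longrightarrow> J [^]\<^bsub>H\<^esub> (m::nat) \<otimes>\<^bsub>H\<^esub> emb l \<in> Aset H lam J emb"
| add: "a \<in> Aset H lam J emb \<Longrightarrow> b \<in> Aset H lam J emb \<Longrightarrow> a \<oplus>\<^bsub>H\<^esub> b \<in> Aset H lam J emb"

locale commuting = ring H for H :: "('h, 'm) ring_scheme" (structure) +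
  fixes lam om :: real and J :: 'h and emb
  assumes J_closed: "J \<in> carrier H"
    and emb_hom: "emb \<in> ring_hom (Lring lam) H"
    and comm: "l \<in> Lset lam \<Longrightarrow> emb l \<otimes> J = J \<otimes> emb l \<oplus> emb (Jhat lam om l)"
begin

lemma emb_closed [simp]: "l \<in> Lset lam \<Longrightarrow> emb l \<in> carrier H"
  using ring_hom_closed[OF emb_hom] by (simp add: Lring_def)

lemma emb_add: "l \<in> Lset lam \<Longrightarrow> l' \<in> Lset lam \<Longrightarrow> emb (\<lambda>p. l p + l' p) = emb l \<oplus> emb l'"
  using ring_hom_add[OF emb_hom] by (simp add: Lring_def)

lemma emb_mult: "l \<in> Lset lam \<Longrightarrow> l' \<in> Lset lam \<Longrightarrow> emb (\<lambda>p. l p * l' p) = emb l \<otimes> emb l'"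
  using ring_hom_mult[OF emb_hom] by (simp add: Lring_def)

lemma emb_one: "emb (\<lambda>p. 1) = \<one>"
  using ring_hom_one[OF emb_hom] by (simp add: Lring_def)

lemma emb_zero: "emb (\<lambda>p. 0) = \<zero>"
proof -
  have "emb (\<lambda>p. 0) \<oplus> emb (\<lambda>p. 0) = emb (\<lambda>p. 0)"
    using emb_add[OF Lset_zero Lset_zero] by simp
  thus ?thesis by (simp add: Lset_zero)
qed

lemma Aset_closed: "a \<in> Aset H lam J emb \<Longrightarrow> a \<in> carrier H"
  by (induction rule: Aset.induct) (auto simp: J_closed)

lemma Aset_J: "a \<in> Aset H lam J emb \<Longrightarrow> J \<otimes> a \<in> Aset H lam J emb"
proof (induction rule: Aset.induct)
  case (base l m)
  have "J \<otimes> (J [^] m \<otimes> emb l) = J [^] Suc m \<otimes> emb l"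
    unfolding nat_pow_Suc2[OF J_closed] using base by (simp add: J_closed m_assoc)
  thus ?case using Aset.base[OF base] by metis
qed (auto simp: r_distr J_closed Aset_closed intro: Aset.add)

lemma Aset_emb_pow:
  "l \<in> Lset lam \<Longrightarrow> l' \<in> Lset lam \<Longrightarrow> emb l \<otimes> (J [^] (m::nat) \<otimes> emb l') \<in> Aset H lam J emb"
proof (induction m arbitrary: l)
  case 0
  have "emb l \<otimes> (J [^] (0::nat) \<otimes> emb l') = J [^] (0::nat) \<otimes> emb (\<lambda>p. l p * l' p)"
    using 0 by (simp add: J_closed emb_mult Lset.mult)
  thus ?case using Aset.base[OF Lset.mult[OF 0]] by metis
next
  case (Suc m)
  have "emb l \<otimes> (J [^] Suc m \<otimes> emb l') = (emb l \<otimes> J) \<otimes> (J [^] m \<otimes> emb l')"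
    unfolding nat_pow_Suc2[OF J_closed] using Suc.prems by (simp add: J_closed m_assoc)
  also have "\<dots> = J \<otimes> (emb l \<otimes> (J [^] m \<otimes> emb l')) \<oplus> emb (Jhat lam om l) \<otimes> (J [^] m \<otimes> emb l')"
    using Suc.prems by (simp add: comm l_distr m_assoc J_closed Jhat_closed)
  finally show ?case
    using Suc by (auto intro!: Aset.add Aset_J Jhat_closed)
qed

lemma Aset_emb: "a \<in> Aset H lam J emb \<Longrightarrow> l \<in> Lset lam \<Longrightarrow> emb l \<otimes> a \<in> Aset H lam J emb"
  by (induction rule: Aset.induct)
     (auto intro: Aset.add Aset_emb_pow simp: r_distr Aset_closed)

lemma normal_form_superset:
  assumes "\<And>m. l m \<in> Lset lam" "finite B" "{m. l m \<noteq> (\<lambda>p. 0)} \<subseteq> B"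
  shows "normal_form H lam J emb h l \<longleftrightarrow> h = (\<Oplus> m \<in> B. J [^] m \<otimes> emb (l m))"
proof -
  have "(\<Oplus> m \<in> {m. l m \<noteq> (\<lambda>p. 0)}. J [^] m \<otimes> emb (l m)) = (\<Oplus> m \<in> B. J [^] m \<otimes> emb (l m))"
    by (rule add.finprod_mono_neutral_cong_left) (use assms in \<open>auto simp: emb_zero J_closed\<close>)
  thus ?thesis
    using assms finite_subset[of _ B] by (auto simp: normal_form_def)
qed

lemma Aset_normal_form: "a \<in> Aset H lam J emb \<Longrightarrow> \<exists>l. normal_form H lam J emb a l"
proof (induction rule: Aset.induct)
  case (base l m)
  have "normal_form H lam J emb (J [^] m \<otimes> emb l) (\<lambda>k. if k = m then l else (\<lambda>p. 0))"
    by (subst normal_form_superset[of _ "{m}"]) (use base in \<open>auto simp: Lset_zero J_closed\<close>)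
  thus ?case by blast
next
  case (add a b)
  then obtain l l' where nf: "normal_form H lam J emb a l" "normal_form H lam J emb b l'" by blast
  let ?B = "{m. l m \<noteq> (\<lambda>p. 0)} \<union> {m. l' m \<noteq> (\<lambda>p. 0)}"
  have L: "l m \<in> Lset lam" "l' m \<in> Lset lam" and B: "finite ?B" for m
    using nf by (auto simp: normal_form_def)
  have a: "a = (\<Oplus> m \<in> ?B. J [^] m \<otimes> emb (l m))" "b = (\<Oplus> m \<in> ?B. J [^] m \<otimes> emb (l' m))"
    using nf normal_form_superset[of l ?B a] normal_form_superset[of l' ?B b] L B by auto
  have "normal_form H lam J emb (a \<oplus> b) (\<lambda>m p. l m p + l' m p)"
  proof (subst normal_form_superset[of _ ?B])
    have "(\<Oplus> m \<in> ?B. J [^] m \<otimes> emb (\<lambda>p. l m p + l' m p)) =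
      (\<Oplus> m \<in> ?B. J [^] m \<otimes> emb (l m) \<oplus> J [^] m \<otimes> emb (l' m))"
      by (rule finsum_cong') (auto simp: emb_add L r_distr J_closed)
    also have "\<dots> = a \<oplus> b"
      unfolding a by (rule finsum_addf) (auto simp: L J_closed)
    finally show "a \<oplus> b = (\<Oplus> m \<in> ?B. J [^] m \<otimes> emb (\<lambda>p. l m p + l' m p))" ..
  qed (use L B in \<open>auto intro: Lset.add\<close>)
  thus ?case by blast
qed

end

lemma Hmodel_commuting: "commuting (Hmodel lam om) lam om (opJ lam om) (opL lam)"
proof -
  interpret ring "Hmodel lam om" by (rule Hmodel_ring)
  note ap = opL_one opL_apply op_add_apply op_mult_apply Kset_closed
  show ?thesis
  proof unfold_locales
    show "opL lam \<in> ring_hom (Lring lam) (Hmodel lam om)"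
      by (auto simp: ring_hom_def Lring_def Hmodel_def ap algebra_simps Kset.L
          intro!: Kset.intros Lset.intros Kset_eqI[of _ lam om])
  next
    fix l assume l: "l \<in> Lset lam"
    have "op_mult lam (opL lam l) (opJ lam om) =
        op_add lam (op_mult lam (opJ lam om) (opL lam l)) (opL lam (Jhat lam om l))"
    proof (rule Kset_eqI[of _ lam om])
      fix c m p assume c: "c \<in> Mset lam"
      have "opL lam l c \<in> Mset lam" using Kset_closed[OF Kset.L[OF l] c] .
      moreover have "opL lam l c m = (\<lambda>p. l p * c m p)" for m using c by (simp add: opL_def)
      moreover have "c m \<in> Lset lam" using c by (simp add: Mset_def)
      ultimately show "op_mult lam (opL lam l) (opJ lam om) c m p =
          op_add lam (op_mult lam (opJ lam om) (opL lam l)) (opL lam (Jhat lam om l)) c m p"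
        using l c Kset_closed[OF Kset.J c]
        by (simp add: ap) (simp add: opJ_def Jhat_mult algebra_simps)
    qed (auto intro!: Kset.intros l Jhat_closed)
    thus "opL lam l \<otimes>\<^bsub>Hmodel lam om\<^esub> opJ lam om = opJ lam om \<otimes>\<^bsub>Hmodel lam om\<^esub> opL lam l
        \<oplus>\<^bsub>Hmodel lam om\<^esub> opL lam (Jhat lam om l)" by (simp add: Hmodel_def)
  qed (simp add: Hmodel_def Kset.J)
qed

lemma Hmodel_sum_apply:
  assumes "finite B" "\<And>m. m \<in> B \<Longrightarrow> T m \<in> Kset lam om" "c \<in> Mset lam"
  shows "finsum (Hmodel lam om) T B c n p = (\<Sum>m\<in>B. T m c n p)"
proof -
  interpret ring "Hmodel lam om" by (rule Hmodel_ring)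
  show ?thesis using assms
  proof (induction B)
    case empty
    then have "\<zero>\<^bsub>Hmodel lam om\<^esub> c n p = 0" by (simp add: Hmodel_def opL_def)
    then show ?case by simp
  next
    case (insert x B)
    have "finsum (Hmodel lam om) T (insert x B) = T x \<oplus>\<^bsub>Hmodel lam om\<^esub> finsum (Hmodel lam om) T B"
      by (rule finsum_insert) (use insert in \<open>auto simp: Hmodel_def\<close>)
    then show ?case using insert by (simp add: Hmodel_def op_add_def)
  qed
qed

lemma opJ_pow:
  assumes "c \<in> Mset lam" "\<And>n. n > k \<Longrightarrow> c n = (\<lambda>p. 0)"
  shows "(opJ lam om [^]\<^bsub>Hmodel lam om\<^esub> (m::nat)) c (k + m) = c k \<and>
    (\<forall>n > k + m. (opJ lam om [^]\<^bsub>Hmodel lam om\<^esub> m) c n = (\<lambda>p. 0))"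
  using assms
proof (induction m arbitrary: c k)
  case 0
  then show ?case by (simp add: Hmodel_def opL_one)
next
  case (Suc m)
  let ?d = "opJ lam om c"
  have d: "?d \<in> Mset lam" using Kset_closed[OF Kset.J Suc.prems(1)] .
  have top: "?d (Suc k) = c k" and above: "n > Suc k \<Longrightarrow> ?d n = (\<lambda>p. 0)" for n
    using Suc.prems by (auto simp: opJ_def Jhat_const)
  have "(opJ lam om [^]\<^bsub>Hmodel lam om\<^esub> Suc m) c = (opJ lam om [^]\<^bsub>Hmodel lam om\<^esub> m) ?d"
    using Suc.prems by (simp add: Hmodel_def op_mult_apply)
  moreover have "(opJ lam om [^]\<^bsub>Hmodel lam om\<^esub> m) ?d (Suc k + m) = ?d (Suc k) \<and>
      (\<forall>n > Suc k + m. (opJ lam om [^]\<^bsub>Hmodel lam om\<^esub> m) ?d n = (\<lambda>p. 0))"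
    by (rule Suc.IH[OF d above])
  ultimately show ?case using top by (simp del: nat_pow_Suc)
qed

lemma Hmodel_normal_form_unique:
  assumes "normal_form (Hmodel lam om) lam (opJ lam om) (opL lam) h l"
    and "normal_form (Hmodel lam om) lam (opJ lam om) (opL lam) h l'"
  shows "l = l'"
proof (rule ccontr)
  interpret commuting "Hmodel lam om" lam om "opJ lam om" "opL lam" by (rule Hmodel_commuting)
  define B where "B = {m. l m \<noteq> (\<lambda>p. 0)} \<union> {m. l' m \<noteq> (\<lambda>p. 0)}"
  have L: "l m \<in> Lset lam" "l' m \<in> Lset lam" and B: "finite B" for m
    using assms by (auto simp: normal_form_def B_def)
  define c :: "nat \<Rightarrow> real \<times> real \<Rightarrow> complex" where "c = (\<lambda>n p. if n = 0 then 1 else 0)"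
  have c: "c \<in> Mset lam"
    unfolding Mset_def c_def by (auto intro: Lset.const)
  define E where "E = (\<lambda>(k :: nat \<Rightarrow> real \<times> real \<Rightarrow> complex) m. (opJ lam om [^]\<^bsub>Hmodel lam om\<^esub> m) (opL lam (k m) c))"
  have eval: "h c n p = (\<Sum>m\<in>B. E k m n p)"
    if "normal_form (Hmodel lam om) lam (opJ lam om) (opL lam) h k" "k = l \<or> k = l'" for n p k
  proof -
    have k: "k m \<in> Lset lam" for m using that L by auto
    have *: "opJ lam om [^]\<^bsub>Hmodel lam om\<^esub> m \<otimes>\<^bsub>Hmodel lam om\<^esub> opL lam (k m) \<in> Kset lam om" for m
      using m_closed[OF nat_pow_closed[OF J_closed] emb_closed[OF k]] by (simp add: Hmodel_def)
    have "h = (\<Oplus>\<^bsub>Hmodel lam om\<^esub> m \<in> B. opJ lam om [^]\<^bsub>Hmodel lam om\<^esub> m \<otimes>\<^bsub>Hmodel lam om\<^esub> opL lam (k m))"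
      using that normal_form_superset[of k B h] k B by (auto simp: B_def)
    hence "h c n p = (\<Sum>m\<in>B. (opJ lam om [^]\<^bsub>Hmodel lam om\<^esub> m \<otimes>\<^bsub>Hmodel lam om\<^esub> opL lam (k m)) c n p)"
      using Hmodel_sum_apply[OF B * c] by simp
    also have "\<dots> = (\<Sum>m\<in>B. E k m n p)"
      unfolding E_def by (rule sum.cong) (use c in \<open>auto simp: Hmodel_def op_mult_apply\<close>)
    finally show ?thesis .
  qed
  have E: "E k m m = k m" "n > m \<Longrightarrow> E k m n = (\<lambda>p. 0)" if "k = l \<or> k = l'" for k m n
  proof -
    have k: "k m \<in> Lset lam" using that L by auto
    have d: "opL lam (k m) c = (\<lambda>n p. if n = 0 then k m p else 0)"
      using c by (auto simp: opL_def c_def fun_eq_iff)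
    show "E k m m = k m" "n > m \<Longrightarrow> E k m n = (\<lambda>p. 0)"
      using opJ_pow[OF Kset_closed[OF Kset.L[OF k] c], of 0 om m] by (auto simp: E_def d)
  qed
  assume "l \<noteq> l'"
  define D where "D = {m. l m \<noteq> l' m}"
  have "D \<subseteq> B" unfolding D_def B_def by auto
  hence fin: "finite D" using B finite_subset by blast
  have "D \<noteq> {}" using \<open>l \<noteq> l'\<close> by (auto simp: D_def)
  define N where "N = Max D"
  have N: "N \<in> D" and above: "\<And>m. m > N \<Longrightarrow> l m = l' m"
    using Max_in[OF fin \<open>D \<noteq> {}\<close>] Max_ge[OF fin] by (auto simp: N_def D_def leD)
  have "l N p = l' N p" for p
  proof -
    have split: "(\<Sum>m\<in>B. E k m N p) = k N p + (\<Sum>m\<in>{m\<in>B. m > N}. E k m N p)"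
      if k: "k = l \<or> k = l'" for k
    proof -
      have "(\<Sum>m\<in>B. E k m N p) = (\<Sum>m\<in>insert N {m\<in>B. m > N}. E k m N p)"
        using N \<open>D \<subseteq> B\<close> E(2)[OF k]
        by (intro sum.mono_neutral_right) (auto simp: B, metis nat_neq_iff)
      thus ?thesis using B E(1)[OF k] by simp
    qed
    have "(\<Sum>m\<in>{m\<in>B. m > N}. E l m N p) = (\<Sum>m\<in>{m\<in>B. m > N}. E l' m N p)"
      by (rule sum.cong) (auto simp: E_def above)
    thus ?thesis
      using eval[OF assms(1), of N p] eval[OF assms(2), of N p] split[of l] split[of l'] by simp
  qed
  with N show False by (auto simp: D_def)
qed

theorem Hmodel_U_iso2: "U_iso2 (Hmodel lam om) lam om (opJ lam om) (opL lam)"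
proof -
  interpret commuting "Hmodel lam om" lam om "opJ lam om" "opL lam" by (rule Hmodel_commuting)
  show ?thesis
  proof unfold_locales
    fix l assume l: "l \<in> Lset lam"
    have "opL lam l \<otimes>\<^bsub>Hmodel lam om\<^esub> opJ lam om \<ominus>\<^bsub>Hmodel lam om\<^esub> opJ lam om \<otimes>\<^bsub>Hmodel lam om\<^esub> opL lam l
      = (opL lam (Jhat lam om l) \<oplus>\<^bsub>Hmodel lam om\<^esub> opJ lam om \<otimes>\<^bsub>Hmodel lam om\<^esub> opL lam l)
         \<ominus>\<^bsub>Hmodel lam om\<^esub> opJ lam om \<otimes>\<^bsub>Hmodel lam om\<^esub> opL lam l"
      using l by (simp add: comm J_closed Jhat_closed a_comm)
    also have "\<dots> = opL lam (Jhat lam om l)"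
      using l by (simp add: J_closed Jhat_closed a_minus_def a_assoc r_neg)
    finally show "opL lam l \<otimes>\<^bsub>Hmodel lam om\<^esub> opJ lam om \<ominus>\<^bsub>Hmodel lam om\<^esub> opJ lam om \<otimes>\<^bsub>Hmodel lam om\<^esub> opL lam l
      = opL lam (Jhat lam om l)" .
  next
    fix h assume "h \<in> carrier (Hmodel lam om)"
    hence h: "h \<in> Kset lam om" by (simp add: Hmodel_def)
    have "\<forall>a \<in> Aset (Hmodel lam om) lam (opJ lam om) (opL lam).
      h \<otimes>\<^bsub>Hmodel lam om\<^esub> a \<in> Aset (Hmodel lam om) lam (opJ lam om) (opL lam)"
      using h
    proof induction
      case J
      then show ?case using Aset_J by blast
    next
      case (L l)
      then show ?case using Aset_emb by blast
    next
      case (add T U)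
      have "op_add lam T U = T \<oplus>\<^bsub>Hmodel lam om\<^esub> U" "T \<in> carrier (Hmodel lam om)" "U \<in> carrier (Hmodel lam om)"
        using add.hyps by (simp_all add: Hmodel_def)
      then show ?case using add.IH by (auto simp: l_distr Aset_closed intro: Aset.add)
    next
      case (mult T U)
      have "op_mult lam T U = T \<otimes>\<^bsub>Hmodel lam om\<^esub> U" "T \<in> carrier (Hmodel lam om)" "U \<in> carrier (Hmodel lam om)"
        using mult.hyps by (simp_all add: Hmodel_def)
      then show ?case using mult.IH by (auto simp: m_assoc Aset_closed)
    qed
    moreover have "\<one>\<^bsub>Hmodel lam om\<^esub> \<in> Aset (Hmodel lam om) lam (opJ lam om) (opL lam)"
      using Aset.base[OF Lset.const[of 1 lam], where m = 0 and H = "Hmodel lam om" and emb = "opL lam" and J = "opJ lam om"]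
      by (simp add: emb_one)
    ultimately have "h \<in> Aset (Hmodel lam om) lam (opJ lam om) (opL lam)"
      using \<open>h \<in> carrier (Hmodel lam om)\<close> by fastforce
    from Aset_normal_form[OF this]
    show "\<exists>!l. normal_form (Hmodel lam om) lam (opJ lam om) (opL lam) h l"
      using Hmodel_normal_form_unique by blast
  qed (auto intro: J_closed emb_hom)
qed

end

theory Submission
  imports Defs
begin

text \<open>
  Moving \<open>l \<in> \<L>\<close> to the right of a power of J and expanding at the origin shows that \<open>f \<prec> l\<close> is obtained
  from f by the operator with symbol \<open>exp (\<phi> Jhat) l\<close>, where the coordinates of \<open>\<real>\<^sup>2\<close> become the
  derivatives in a1 and a2. The symbols X, Y, G, F of P1, P2, \<open>exp (\<lambda> P2)\<close>, \<open>exp (- \<lambda> P2)\<close> satisfy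
  in \<open>\<phi>\<close> the differential equations of the flow of Jhat. This system is not linear, but
  \<open>K = G + F + \<omega> \<lambda>\<^sup>2 X\<^sup>2 G\<close> is constant along the flow, and with \<open>N = 2 \<lambda> X G\<close> one gets the linear system
  \<open>N' = K - 2 G\<close>, \<open>2 G' = \<omega> N\<close>, which is solved by the closed forms in C and S. Finally
  \<open>(\<lambda> Y)' = \<omega> \<lambda> X = G' / G\<close> gives \<open>\<lambda> Y = ln G\<close>.
\<close>

section \<open>Divided powers of derivations\<close>

text \<open>\<open>pd1\<close>, \<open>pd2\<close> and \<open>Jhat\<close> are all derivations of
  \<open>Lset\<close>, so one Leibniz formula serves both the Taylor expansion and the flow.\<close>

locale derivation =
  fixes lam :: real and d :: "(real \<times> real \<Rightarrow> complex) \<Rightarrow> real \<times> real \<Rightarrow> complex"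
  assumes closed: "l \<in> Lset lam \<Longrightarrow> d l \<in> Lset lam"
    and add: "l \<in> Lset lam \<Longrightarrow> l' \<in> Lset lam \<Longrightarrow> d (\<lambda>p. l p + l' p) = (\<lambda>p. d l p + d l' p)"
    and mult: "l \<in> Lset lam \<Longrightarrow> l' \<in> Lset lam \<Longrightarrow>
      d (\<lambda>p. l p * l' p) = (\<lambda>p. l p * d l' p + d l p * l' p)"
    and const: "d (\<lambda>p. c) = (\<lambda>p. 0)"
begin

lemma scale: "l \<in> Lset lam \<Longrightarrow> d (\<lambda>p. c * l p) = (\<lambda>p. c * d l p)"
  using mult[OF Lset.const[of c]] by (simp add: const)

lemma sum:
  assumes "\<And>i. i \<in> I \<Longrightarrow> l i \<in> Lset lam"
  shows "d (\<lambda>p. \<Sum>i\<in>I. l i p) = (\<lambda>p. \<Sum>i\<in>I. d (l i) p)"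
  using assms
  by (induction I rule: infinite_finite_induct) (auto simp: const add Lset_sum)

text \<open>The division by n! turns the binomial Leibniz rule into a Cauchy product, so generating
  series over n become multiplicative.\<close>

definition dpow :: "nat \<Rightarrow> (real \<times> real \<Rightarrow> complex) \<Rightarrow> real \<times> real \<Rightarrow> complex" where
  "dpow n l = (\<lambda>p. (d ^^ n) l p / fact n)"

lemma funpow_closed: "l \<in> Lset lam \<Longrightarrow> (d ^^ n) l \<in> Lset lam"
  by (induction n) (auto intro: closed)

lemma dpow_closed: "l \<in> Lset lam \<Longrightarrow> dpow n l \<in> Lset lam"
  using Lset.mult[OF Lset.const[of "1 / fact n"] funpow_closed] by (simp add: dpow_def)

lemma dpow_0 [simp]: "dpow 0 l = l"
  by (simp add: dpow_def)

lemma d_dpow: "l \<in> Lset lam \<Longrightarrow> d (dpow n l) = (\<lambda>p. of_nat (Suc n) * dpow (Suc n) l p)"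
  using scale[OF funpow_closed, of l "1 / fact n" n]
  by (simp add: dpow_def field_simps fun_eq_iff del: of_nat_Suc)

lemma dpow_d: "of_nat (Suc n) * dpow (Suc n) l p = dpow n (d l) p"
  by (simp add: dpow_def funpow_swap1 field_simps del: of_nat_Suc)

lemma dpow_add:
  assumes "l \<in> Lset lam" "l' \<in> Lset lam"
  shows "dpow n (\<lambda>p. l p + l' p) = (\<lambda>p. dpow n l p + dpow n l' p)"
proof -
  have "(d ^^ n) (\<lambda>p. l p + l' p) = (\<lambda>p. (d ^^ n) l p + (d ^^ n) l' p)"
    by (induction n) (simp_all add: add funpow_closed assms)
  thus ?thesis by (simp add: dpow_def add_divide_distrib)
qed

lemma dpow_const: "dpow n (\<lambda>p. c) = (\<lambda>p. if n = 0 then c else 0)"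
proof -
  have "(d ^^ n) (\<lambda>p. c) = (\<lambda>p. if n = 0 then c else 0)"
    by (induction n) (simp_all add: const)
  thus ?thesis by (simp add: dpow_def fun_eq_iff)
qed

lemma dpow_sum:
  assumes "\<And>i. i \<in> I \<Longrightarrow> l i \<in> Lset lam"
  shows "dpow n (\<lambda>p. \<Sum>i\<in>I. l i p) = (\<lambda>p. \<Sum>i\<in>I. dpow n (l i) p)"
  using assms
  by (induction I rule: infinite_finite_induct) (auto simp: dpow_const dpow_add Lset_sum)

lemma dpow_mult:
  assumes "l \<in> Lset lam" "l' \<in> Lset lam"
  shows "dpow n (\<lambda>p. l p * l' p) = (\<lambda>p. \<Sum>i=0..n. dpow i l p * dpow (n - i) l' p)"
proof (induction n)
  case (Suc n)
  \<comment> \<open>Multiplying by n+1 clears the denominators. The factor is recovered at the end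
    as (n+1-i) + i, the two parts of the product rule; the added terms i = n+1 and i = 0 have weight
    zero.\<close>
  have "of_nat (Suc n) * dpow (Suc n) (\<lambda>p. l p * l' p) p =
      of_nat (Suc n) * (\<Sum>i=0..Suc n. dpow i l p * dpow (Suc n - i) l' p)" for p
  proof -
    let ?a = "\<lambda>i. dpow i l p" and ?b = "\<lambda>i. dpow i l' p"
    have "of_nat (Suc n) * dpow (Suc n) (\<lambda>p. l p * l' p) p
        = d (\<lambda>p. \<Sum>i=0..n. dpow i l p * dpow (n - i) l' p) p"
      using d_dpow[OF Lset.mult[OF assms], of n] Suc.IH by simp
    also have "\<dots> = (\<Sum>i=0..n. dpow i l p * d (dpow (n - i) l') p + d (dpow i l) p * dpow (n - i) l' p)"
      by (simp add: sum mult Lset.mult dpow_closed assms)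
    also have "\<dots> = (\<Sum>i=0..n. of_nat (Suc n - i) * (?a i * ?b (Suc n - i)))
        + (\<Sum>i=0..n. of_nat (Suc i) * (?a (Suc i) * ?b (n - i)))"
      unfolding sum.distrib[symmetric]
      by (rule sum.cong) (simp_all add: d_dpow assms Suc_diff_le algebra_simps)
    also have "(\<Sum>i=0..n. of_nat (Suc n - i) * (?a i * ?b (Suc n - i)))
        = (\<Sum>i=0..Suc n. of_nat (Suc n - i) * (?a i * ?b (Suc n - i)))"
      by (simp add: sum.atLeast0_atMost_Suc)
    also have "(\<Sum>i=0..n. of_nat (Suc i) * (?a (Suc i) * ?b (n - i)))
        = (\<Sum>i=0..Suc n. of_nat i * (?a i * ?b (Suc n - i)))"
      by (simp only: sum.atLeast0_atMost_Suc_shift diff_Suc_Suc o_def) simp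
    also have "(\<Sum>i=0..Suc n. of_nat (Suc n - i) * (?a i * ?b (Suc n - i)))
        + (\<Sum>i=0..Suc n. of_nat i * (?a i * ?b (Suc n - i)))
        = (\<Sum>i=0..Suc n. of_nat (Suc n) * (?a i * ?b (Suc n - i)))"
      unfolding sum.distrib[symmetric]
      by (rule sum.cong) (auto simp: distrib_right[symmetric] of_nat_add[symmetric] simp del: of_nat_Suc of_nat_add)
    finally show ?thesis by (simp only: sum_distrib_left)
  qed
  thus ?case by (simp add: fun_eq_iff del: of_nat_Suc)
qed simp

end

lemma derivation_pd1: "derivation lam pd1" and derivation_pd2: "derivation lam pd2"
  by (unfold_locales; auto simp: pd_closed pd_add pd_mult fun_eq_iff; simp add: pd1_def pd2_def)+

lemma derivation_Jhat: "derivation lam (Jhat lam om)"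
  by unfold_locales (auto simp: Jhat_closed Jhat_add Jhat_mult Jhat_const fun_eq_iff)

section \<open>Taylor series at the origin and the flow of $\hat J$\<close>

text \<open>The outer index counts derivatives in the second coordinate, in agreement with
  \<open>series3\<close>, where \<open>D2\<close> is outermost.\<close>

definition taylor :: "(real \<times> real \<Rightarrow> complex) \<Rightarrow> complex fps fps" where
  "taylor l = Abs_fps (\<lambda>s. Abs_fps (\<lambda>r. derivation.dpow pd1 r (derivation.dpow pd2 s l) (0, 0)))"

lemma fps2_mult_nth:
  fixes U V :: "'a::comm_semiring_1 fps fps"
  shows "(U * V) $ s $ r = (\<Sum>j=0..s. \<Sum>i=0..r. U $ j $ i * V $ (s - j) $ (r - i))"
  by (simp add: fps_mult_nth fps_sum_nth)

text \<open>Links the divided powers, which make \<open>taylor\<close> multiplicative, with the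
  plain iterated derivatives in \<open>pairing\<close>.\<close>

lemma taylor_nth:
  assumes "l \<in> Lset lam"
  shows "taylor l $ s $ r = (pd1 ^^ r) ((pd2 ^^ s) l) (0, 0) / (fact r * fact s)"
proof -
  interpret d1: derivation lam pd1 by (rule derivation_pd1)
  interpret d2: derivation lam pd2 by (rule derivation_pd2)
  have "d1.dpow r (\<lambda>p. (1 / fact s) * (pd2 ^^ s) l p) = (\<lambda>p. (1 / fact s) * d1.dpow r ((pd2 ^^ s) l) p)"
  proof -
    have "d1.dpow r (\<lambda>p. (1 / fact s) * (pd2 ^^ s) l p) =
      (\<lambda>p. \<Sum>i=0..r. (if i = 0 then 1 / fact s else 0) * d1.dpow (r - i) ((pd2 ^^ s) l) p)"
      by (subst d1.dpow_mult) (auto simp: Lset.const d2.funpow_closed assms d1.dpow_const)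
    also have "\<dots> = (\<lambda>p. (1 / fact s) * d1.dpow r ((pd2 ^^ s) l) p)"
      by (simp add: if_distrib[of "\<lambda>x. x * _"] sum.delta cong: if_cong)
    finally show ?thesis .
  qed
  thus ?thesis by (simp add: taylor_def d2.dpow_def) (simp add: d1.dpow_def mult.commute)
qed

context
  fixes lam :: real
begin

interpretation d1: derivation lam pd1 by (rule derivation_pd1)
interpretation d2: derivation lam pd2 by (rule derivation_pd2)

lemma taylor_add:
  "l \<in> Lset lam \<Longrightarrow> l' \<in> Lset lam \<Longrightarrow> taylor (\<lambda>p. l p + l' p) = taylor l + taylor l'"
  by (simp add: taylor_def fps_eq_iff d2.dpow_add d1.dpow_add d2.dpow_closed)

lemma taylor_const: "taylor (\<lambda>p. c) = fps_const (fps_const c)"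
  by (auto simp: taylor_def fps_eq_iff d2.dpow_const d1.dpow_const)

lemma taylor_sum:
  "(\<And>i. i \<in> I \<Longrightarrow> l i \<in> Lset lam) \<Longrightarrow> taylor (\<lambda>p. \<Sum>i\<in>I. l i p) = (\<Sum>i\<in>I. taylor (l i))"
  by (induction I rule: infinite_finite_induct) (auto simp: taylor_const taylor_add Lset_sum)

text \<open>Two applications of \<open>dpow_mult\<close>, first for \<open>pd2\<close> and then for
  \<open>pd1\<close>, give the Cauchy product in two variables.\<close>

lemma taylor_mult:
  assumes "l \<in> Lset lam" "l' \<in> Lset lam"
  shows "taylor (\<lambda>p. l p * l' p) = taylor l * taylor l'"
proof (intro fps_ext)
  fix s r
  have "taylor (\<lambda>p. l p * l' p) $ s $ r =
    (\<Sum>j=0..s. d1.dpow r (\<lambda>p. d2.dpow j l p * d2.dpow (s - j) l' p) (0, 0))"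
    by (simp add: taylor_def d2.dpow_mult assms d1.dpow_sum Lset.mult d2.dpow_closed)
  also have "\<dots> = (taylor l * taylor l') $ s $ r"
    by (simp add: fps2_mult_nth d1.dpow_mult d2.dpow_closed assms taylor_def)
  finally show "taylor (\<lambda>p. l p * l' p) $ s $ r = (taylor l * taylor l') $ s $ r" .
qed

lemma taylor_power:
  assumes "l \<in> Lset lam"
  shows "(\<lambda>p. l p ^ n) \<in> Lset lam" "taylor (\<lambda>p. l p ^ n) = taylor l ^ n"
proof -
  have "(\<lambda>p. l p ^ n) \<in> Lset lam \<and> taylor (\<lambda>p. l p ^ n) = taylor l ^ n"
    using assms by (induction n) (simp_all add: Lset.const taylor_const Lset.mult taylor_mult)
  thus "(\<lambda>p. l p ^ n) \<in> Lset lam" "taylor (\<lambda>p. l p ^ n) = taylor l ^ n" by auto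
qed

end

section \<open>Taylor series of the coordinates and the exponentials\<close>

lemma pd_fst:
  "pd1 (\<lambda>p. of_real (fst p)) = (\<lambda>p. 1)" "pd2 (\<lambda>p. of_real (fst p)) = (\<lambda>p. 0)"
  by (auto simp: pd1_def pd2_def fun_eq_iff
      intro!: vector_derivative_at derivative_eq_intros)

lemma pd_snd:
  "pd1 (\<lambda>p. of_real (snd p)) = (\<lambda>p. 0)" "pd2 (\<lambda>p. of_real (snd p)) = (\<lambda>p. 1)"
  by (auto simp: pd1_def pd2_def fun_eq_iff
      intro!: vector_derivative_at derivative_eq_intros)

lemma pd_exp:
  "pd1 (\<lambda>p. exp (of_real (k * snd p))) = (\<lambda>p. 0)"
  "pd2 (\<lambda>p. exp (of_real (k * snd p))) = (\<lambda>p. of_real k * exp (of_real (k * snd p)))"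
  using vector_derivative_at[OF exp_vector_derivative[of k]]
  by (auto simp: pd1_def pd2_def fun_eq_iff)

lemma pd_const: "pd1 (\<lambda>p. c) = (\<lambda>p. 0)" "pd2 (\<lambda>p. c) = (\<lambda>p. 0)"
  by (auto simp: pd1_def pd2_def fun_eq_iff)

lemma funpow_eq_zero:
  assumes "d l = (\<lambda>p. 0)" "d (\<lambda>p. 0) = (\<lambda>p. 0)"
  shows "(d ^^ n) l = (if n = 0 then l else (\<lambda>p. 0 :: complex))"
proof (cases n)
  case (Suc m)
  have "(d ^^ m) (\<lambda>p. 0) = (\<lambda>p. 0)" using assms(2) by (induction m) auto
  thus ?thesis using assms(1) Suc by (simp add: funpow_swap1)
qed simp

lemma funpow_pd_const: "(pd1 ^^ n) (\<lambda>p. c) = (if n = 0 then (\<lambda>p. c) else (\<lambda>p. 0))"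
   "(pd2 ^^ n) (\<lambda>p. c) = (if n = 0 then (\<lambda>p. c) else (\<lambda>p. 0))"
  by (rule funpow_eq_zero; simp add: pd_const)+

lemma taylor_fst: "taylor (\<lambda>p. of_real (fst p)) = fps_const fps_X"
proof (intro fps_ext)
  fix s r
  have 1: "(pd2 ^^ s) (\<lambda>p. of_real (fst p)) = (if s = 0 then (\<lambda>p. of_real (fst p)) else (\<lambda>p. 0))"
    by (rule funpow_eq_zero) (simp_all add: pd_fst pd_const)
  show "taylor (\<lambda>p. of_real (fst p)) $ s $ r = fps_const fps_X $ s $ r"
    unfolding taylor_nth[OF Lset.P1] 1
    by (cases r) (auto simp: funpow_pd_const funpow_swap1 pd_fst pd_const fps_X_def)
qed

lemma taylor_snd: "taylor (\<lambda>p. of_real (snd p)) = fps_X"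
proof (intro fps_ext)
  fix s r
  show "taylor (\<lambda>p. of_real (snd p)) $ s $ r = fps_X $ s $ r"
    unfolding taylor_nth[OF Lset.P2]
    by (cases s; cases r) (auto simp: funpow_pd_const funpow_swap1 pd_snd pd_const fps_X_def)
qed

text \<open>Membership is a hypothesis, so that \<open>k = lam\<close> and \<open>k = - lam\<close>
  are treated at once.\<close>

lemma taylor_exp_nth:
  assumes "(\<lambda>p. exp (of_real (k * snd p))) \<in> Lset lam"
  shows "taylor (\<lambda>p. exp (of_real (k * snd p))) $ s $ r = (if r = 0 then of_real k ^ s / fact s else 0)"
proof -
  interpret d1: derivation lam pd1 by (rule derivation_pd1)
  interpret d2: derivation lam pd2 by (rule derivation_pd2)
  let ?e = "\<lambda>p. exp (of_real (k * snd p)) :: complex"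
  have 2: "(pd2 ^^ s) ?e = (\<lambda>p. of_real k ^ s * ?e p)"
    by (induction s) (simp_all only: funpow.simps o_apply id_apply d2.scale[OF assms] pd_exp power.simps mult_1 mult.assoc mult.left_commute)
  have 1: "(pd1 ^^ r) (\<lambda>p. of_real k ^ s * ?e p) = (if r = 0 then (\<lambda>p. of_real k ^ s * ?e p) else (\<lambda>p. 0))"
    by (rule funpow_eq_zero) (simp_all only: d1.scale[OF assms] pd_exp pd_const mult_zero_right)
  show ?thesis unfolding taylor_nth[OF assms] 2 1 by simp
qed

text \<open>The generating series of \<open>exp (\<phi> Jhat) l\<close>, Taylor expanded at the origin.\<close>

definition flow :: "real \<Rightarrow> real \<Rightarrow> (real \<times> real \<Rightarrow> complex) \<Rightarrow> series3" where
  "flow lam om l = Abs_fps (\<lambda>s. Abs_fps (\<lambda>r. Abs_fps (\<lambda>k.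
     taylor (derivation.dpow (Jhat lam om) k l) $ s $ r)))"

section \<open>Derivative and initial value in phi\<close>

definition d_phi3 :: "series3 \<Rightarrow> series3" where
  "d_phi3 U = Abs_fps (\<lambda>s. Abs_fps (\<lambda>r. fps_deriv (U $ s $ r)))"

text \<open>Kept inside \<open>series3\<close> to be a ring endomorphism; together with
  \<open>d_phi3\<close> it expresses initial value problems in phi.\<close>

definition at_phi0 :: "series3 \<Rightarrow> series3" where
  "at_phi0 U = Abs_fps (\<lambda>s. Abs_fps (\<lambda>r. fps_const (U $ s $ r $ 0)))"

lemma series3_eqI: "(\<And>s r. U $ s $ r = V $ s $ r) \<Longrightarrow> U = (V :: series3)"
  by (intro fps_ext) simp

lemma scal_mult_nth: "(scal c * U) $ s $ r = fps_const c * U $ s $ r"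
  by (simp add: scal_def)

lemma scal_simps:
  "scal 0 = 0" "scal 1 = 1" "scal (a + b) = scal a + scal b" "scal (a - b) = scal a - scal b"
  "scal (- a) = - scal a" "scal (a * b) = scal a * scal b" "scal (a ^ n) = scal a ^ n"
  "scal (numeral m) = numeral m"
  by (simp_all add: scal_def fps_const_power numeral_fps_const)

lemma d_phi3_simps:
  "d_phi3 (U + V) = d_phi3 U + d_phi3 V" "d_phi3 (U - V) = d_phi3 U - d_phi3 V"
  "d_phi3 (- U) = - d_phi3 U"
  "d_phi3 (scal c) = 0" "d_phi3 D1 = 0" "d_phi3 D2 = 0"
  "d_phi3 (U * V) = U * d_phi3 V + d_phi3 U * V"
proof -
  show "d_phi3 (U * V) = U * d_phi3 V + d_phi3 U * V"
  proof (rule series3_eqI)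
    fix s r
    show "d_phi3 (U * V) $ s $ r = (U * d_phi3 V + d_phi3 U * V) $ s $ r"
      by (simp add: d_phi3_def fps2_mult_nth fps_deriv_sum sum.distrib)
  qed
qed (auto simp: d_phi3_def scal_def D1_def D2_def fps_eq_iff fps_X_def)

lemma at_phi0_simps:
  "at_phi0 (U + V) = at_phi0 U + at_phi0 V" "at_phi0 (U - V) = at_phi0 U - at_phi0 V"
  "at_phi0 (- U) = - at_phi0 U"
  "at_phi0 (scal c) = scal c" "at_phi0 1 = 1" "at_phi0 D1 = D1" "at_phi0 D2 = D2"
  "at_phi0 (U * V) = at_phi0 U * at_phi0 V"
proof -
  show "at_phi0 (U * V) = at_phi0 U * at_phi0 V"
  proof (rule series3_eqI)
    fix s r
    have *: "fps_const (\<Sum>i\<in>I. g i) = (\<Sum>i\<in>I. fps_const (g i))" for I and g :: "nat \<Rightarrow> complex"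
      by (induction I rule: infinite_finite_induct) (simp_all add: fps_const_add[symmetric] del: fps_const_add)
    show "at_phi0 (U * V) $ s $ r = (at_phi0 U * at_phi0 V) $ s $ r"
      by (simp add: at_phi0_def fps2_mult_nth fps_sum_nth *)
  qed
qed (auto simp: at_phi0_def scal_def D1_def D2_def fps_eq_iff fps_X_def)

context
  fixes lam om :: real
begin

interpretation dJ: derivation lam "Jhat lam om" by (rule derivation_Jhat)

lemma flow_nth:
  "flow lam om l $ s $ r $ k = taylor (dJ.dpow k l) $ s $ r"
  by (simp add: flow_def)

lemma flow_add:
  "l \<in> Lset lam \<Longrightarrow> l' \<in> Lset lam \<Longrightarrow>
    flow lam om (\<lambda>p. l p + l' p) = flow lam om l + flow lam om l'"
  by (simp add: fps_eq_iff flow_def dJ.dpow_add taylor_add[of _ lam] dJ.dpow_closed)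

lemma flow_const: "flow lam om (\<lambda>p. c) = scal c"
  by (simp add: fps_eq_iff flow_def dJ.dpow_const taylor_const scal_def)

text \<open>The exponential of a derivation is an algebra homomorphism: \<open>dpow_mult\<close>
  handles the index of phi and \<open>taylor_mult\<close> the other two; the sums are reordered to
  put phi innermost.\<close>

lemma flow_mult:
  assumes "l \<in> Lset lam" "l' \<in> Lset lam"
  shows "flow lam om (\<lambda>p. l p * l' p) = flow lam om l * flow lam om l'"
proof (intro fps_ext)
  fix s r k
  have "flow lam om (\<lambda>p. l p * l' p) $ s $ r $ k =
    (\<Sum>a=0..k. \<Sum>j=0..s. \<Sum>i=0..r.
        taylor (dJ.dpow a l) $ j $ i * taylor (dJ.dpow (k - a) l') $ (s - j) $ (r - i))"
    by (simp add: flow_nth dJ.dpow_mult assms taylor_sum[of _ _ lam] Lset.mult dJ.dpow_closed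
        taylor_mult[of _ lam] fps_sum_nth fps2_mult_nth)
  also have "\<dots> = (\<Sum>j=0..s. \<Sum>a=0..k. \<Sum>i=0..r.
        taylor (dJ.dpow a l) $ j $ i * taylor (dJ.dpow (k - a) l') $ (s - j) $ (r - i))"
    by (rule sum.swap)
  also have "\<dots> = (\<Sum>j=0..s. \<Sum>i=0..r. \<Sum>a=0..k.
        taylor (dJ.dpow a l) $ j $ i * taylor (dJ.dpow (k - a) l') $ (s - j) $ (r - i))"
    by (intro sum.cong refl sum.swap)
  also have "\<dots> = (flow lam om l * flow lam om l') $ s $ r $ k"
    by (simp add: fps2_mult_nth fps_sum_nth fps_mult_nth flow_nth)
  finally show "flow lam om (\<lambda>p. l p * l' p) $ s $ r $ k = (flow lam om l * flow lam om l') $ s $ r $ k" .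
qed

text \<open>The factor from differentiating in phi cancels against the divided power. Since the
  extra \<open>Jhat\<close> acts first, its value on a generator becomes a differential equation for
  the flow of that generator.\<close>

lemma d_phi3_flow:
  assumes "l \<in> Lset lam"
  shows "d_phi3 (flow lam om l) = flow lam om (Jhat lam om l)"
proof (intro fps_ext)
  fix s r k
  have "taylor (\<lambda>p. of_nat (Suc k) * dJ.dpow (Suc k) l p) = taylor (dJ.dpow k (Jhat lam om l))"
    by (simp only: dJ.dpow_d)
  hence "fps_const (fps_const (of_nat (Suc k))) * taylor (dJ.dpow (Suc k) l) = taylor (dJ.dpow k (Jhat lam om l))"
    by (simp only: taylor_mult[OF Lset.const dJ.dpow_closed[OF assms]] taylor_const)
  from this[symmetric]
  show "d_phi3 (flow lam om l) $ s $ r $ k = flow lam om (Jhat lam om l) $ s $ r $ k"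
    by (simp add: d_phi3_def flow_nth del: of_nat_Suc)
qed

lemma at_phi0_flow:
  "at_phi0 (flow lam om l) $ s $ r = fps_const (taylor l $ s $ r)"
  by (simp add: at_phi0_def flow_nth)

end

section \<open>The right regular action through the pairing\<close>

text \<open>The contribution of J^m l to \<open>pairing\<close>; it does not involve
  \<open>H\<close>, so the duality with operators can be computed in F alone.\<close>

definition pair_term :: "F \<Rightarrow> nat \<Rightarrow> (real \<times> real \<Rightarrow> complex) \<Rightarrow> complex" where
  "pair_term f m l = (\<Sum>s \<le> degree f. \<Sum>r \<le> degree (coeff f s).
     (coeff (coeff f s) r $ m) * (fact m * (pd1 ^^ r) ((pd2 ^^ s) l) (0, 0)))"

text \<open>A common bound for both indices replaces the ranges in \<open>pairing\<close>, which
  depend on the degrees of f, by a square.\<close>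

definition coeffs_within :: "nat \<Rightarrow> F \<Rightarrow> bool" where
  "coeffs_within N f \<longleftrightarrow> (\<forall>s r. s > N \<or> r > N \<longrightarrow> coeff (coeff f s) r = 0)"

lemma coeffs_within_mono: "coeffs_within N f \<Longrightarrow> N \<le> N' \<Longrightarrow> coeffs_within N' f"
  by (auto simp: coeffs_within_def)

lemma ex_coeffs_within: "\<exists>N. coeffs_within N f"
proof -
  have "coeffs_within (degree f + (\<Sum>s\<le>degree f. degree (coeff f s))) f"
    unfolding coeffs_within_def
  proof (intro allI impI)
    fix s r assume *: "degree f + (\<Sum>s\<le>degree f. degree (coeff f s)) < s \<or>
      degree f + (\<Sum>s\<le>degree f. degree (coeff f s)) < r"
    show "coeff (coeff f s) r = 0"
    proof (cases "s \<le> degree f")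
      case True
      have "degree (coeff f s) \<le> (\<Sum>s\<le>degree f. degree (coeff f s))"
        using True by (intro member_le_sum) auto
      thus ?thesis using * True by (intro coeff_eq_0) auto
    qed (simp add: coeff_eq_0)
  qed
  thus ?thesis ..
qed

text \<open>The factorials of the Taylor coefficients are attached to the coefficients of f, where
  they turn derivatives in a1 and a2 into index shifts.\<close>

lemma pair_term_taylor:
  assumes l: "l \<in> Lset lam" and N: "coeffs_within N f"
  shows "pair_term f m l =
    fact m * (\<Sum>s\<le>N. \<Sum>r\<le>N. fact s * (fact r * (coeff (coeff f s) r $ m)) * taylor l $ s $ r)"
proof -
  let ?t = "\<lambda>s r. fact m * (fact s * (fact r * (coeff (coeff f s) r $ m)) * taylor l $ s $ r)"
  have deg: "degree f \<le> N" "degree (coeff f s) \<le> N" for s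
    using N by (auto simp: coeffs_within_def poly_eq_iff intro!: degree_le)
  have "pair_term f m l = (\<Sum>s\<le>degree f. \<Sum>r\<le>degree (coeff f s). ?t s r)"
    unfolding pair_term_def by (simp add: taylor_nth[OF l] mult.left_commute)
  also have "\<dots> = (\<Sum>s\<le>degree f. \<Sum>r\<le>N. ?t s r)"
    by (intro sum.cong sum.mono_neutral_left refl) (auto simp: deg coeff_eq_0)
  also have "\<dots> = (\<Sum>s\<le>N. \<Sum>r\<le>N. ?t s r)"
    by (intro sum.mono_neutral_left) (auto simp: deg coeff_eq_0)
  finally show ?thesis by (simp add: sum_distrib_left)
qed

lemma pair_term_add:
  assumes "l \<in> Lset lam" "l' \<in> Lset lam"
  shows "pair_term f m (\<lambda>p. l p + l' p) = pair_term f m l + pair_term f m l'"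
proof -
  obtain N where N: "coeffs_within N f" using ex_coeffs_within by blast
  show ?thesis
    unfolding pair_term_taylor[OF Lset.add[OF assms] N] pair_term_taylor[OF assms(1) N]
      pair_term_taylor[OF assms(2) N] taylor_add[OF assms]
    by (simp add: distrib_left sum.distrib)
qed

lemma pair_term_zero: "pair_term f m (\<lambda>p. 0) = 0"
  using pair_term_add[OF Lset_zero Lset_zero, of f m] by simp

text \<open>Makes the facts on \<open>Aset\<close> and normal forms from \<open>commuting\<close>
  available in every realisation of the algebra.\<close>

lemma U_iso2_commuting:
  assumes "U_iso2 H lam om J emb"
  shows "commuting H lam om J emb"
proof -
  interpret U_iso2 H lam om J emb by fact
  show ?thesis
  proof unfold_locales
    fix l assume l: "l \<in> Lset lam"
    have *: "x = y \<oplus>\<^bsub>H\<^esub> (x \<ominus>\<^bsub>H\<^esub> y)" if "x \<in> carrier H" "y \<in> carrier H" for x y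
      using that by (simp add: a_minus_def a_comm[of x "\<ominus>\<^bsub>H\<^esub> y"] r_neg2)
    have "emb l \<in> carrier H" using ring_hom_closed[OF emb_hom] l by (simp add: Lring_def)
    thus "emb l \<otimes>\<^bsub>H\<^esub> J = J \<otimes>\<^bsub>H\<^esub> emb l \<oplus>\<^bsub>H\<^esub> emb (Jhat lam om l)"
      unfolding commutation[OF l, symmetric]
      by (intro * m_closed J_closed)
  qed (fact J_closed emb_hom)+
qed

section \<open>The pairing on the algebra\<close>

sublocale U_iso2 \<subseteq> commuting H lam om J emb
  by (rule U_iso2_commuting) unfold_locales

context U_iso2
begin

lemma finsum_Aset:
  fixes B :: "nat set"
  assumes "finite B" "\<And>m. l m \<in> Lset lam"
  shows "(\<Oplus> m \<in> B. J [^] m \<otimes> emb (l m)) \<in> Aset H lam J emb"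
  using assms
proof (induction B)
  case empty
  have "J [^] (0::nat) \<otimes> emb (\<lambda>p. 0) \<in> Aset H lam J emb"
    by (rule Aset.base[OF Lset_zero])
  thus ?case by (simp add: emb_zero)
next
  case (insert m B)
  have "(\<Oplus> m \<in> insert m B. J [^] m \<otimes> emb (l m)) =
      J [^] m \<otimes> emb (l m) \<oplus> (\<Oplus> m \<in> B. J [^] m \<otimes> emb (l m))"
    using insert.hyps insert.prems by (intro finsum_insert) (simp_all add: J_closed)
  thus ?case using Aset.add[OF Aset.base[OF insert.prems] insert.IH[OF insert.prems]] by simp
qed

text \<open>Reduces statements on all of \<open>H\<close> to the monomials J^m l and their
  sums.\<close>

lemma carrier_Aset: "h \<in> carrier H \<Longrightarrow> h \<in> Aset H lam J emb"
  using decomposition[of h] finsum_Aset by (fastforce simp: normal_form_def)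

lemma coords_eqI:
  assumes "normal_form H lam J emb h l"
  shows "coords H lam J emb h = l"
proof -
  have "h \<in> carrier H"
    using assms by (auto simp: normal_form_def J_closed intro!: finsum_closed)
  thus ?thesis unfolding coords_def using assms by (intro the1_equality decomposition)
qed

lemma pairing_eq_sum:
  assumes "\<And>m. l m \<in> Lset lam" "finite B" "{m. l m \<noteq> (\<lambda>p. 0)} \<subseteq> B"
  shows "pairing H lam J emb (\<Oplus> m \<in> B. J [^] m \<otimes> emb (l m)) f = (\<Sum>m\<in>B. pair_term f m (l m))"
proof -
  have "coords H lam J emb (\<Oplus> m \<in> B. J [^] m \<otimes> emb (l m)) = l"
    by (rule coords_eqI) (simp add: normal_form_superset[OF assms])
  hence "pairing H lam J emb (\<Oplus> m \<in> B. J [^] m \<otimes> emb (l m)) f =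
      (\<Sum>m | l m \<noteq> (\<lambda>p. 0). pair_term f m (l m))"
    by (simp add: pairing_def pair_term_def)
  also have "\<dots> = (\<Sum>m\<in>B. pair_term f m (l m))"
    using assms by (intro sum.mono_neutral_left) (auto simp: pair_term_zero)
  finally show ?thesis .
qed

lemma pairing_monomial:
  assumes "l \<in> Lset lam"
  shows "pairing H lam J emb (J [^] (m::nat) \<otimes> emb l) f = pair_term f m l"
proof -
  let ?l = "\<lambda>k. if k = m then l else (\<lambda>p. 0)"
  have "pairing H lam J emb (\<Oplus> k \<in> {m}. J [^] k \<otimes> emb (?l k)) f = (\<Sum>k\<in>{m}. pair_term f k (?l k))"
    by (rule pairing_eq_sum) (use assms in \<open>auto simp: Lset_zero\<close>)
  thus ?thesis using assms by (simp add: J_closed)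
qed

lemma pairing_add:
  assumes "a \<in> carrier H" "b \<in> carrier H"
  shows "pairing H lam J emb (a \<oplus> b) f = pairing H lam J emb a f + pairing H lam J emb b f"
proof -
  obtain l l' where nf: "normal_form H lam J emb a l" "normal_form H lam J emb b l'"
    using decomposition[OF assms(1)] decomposition[OF assms(2)] by (elim ex1E)
  \<comment> \<open>Terms may cancel in the sum, so the union only bounds its support.\<close>
  let ?B = "{m. l m \<noteq> (\<lambda>p. 0)} \<union> {m. l' m \<noteq> (\<lambda>p. 0)}"
  have L: "l m \<in> Lset lam" "l' m \<in> Lset lam" and B: "finite ?B" for m
    using nf by (auto simp: normal_form_def)
  have a: "a = (\<Oplus> m \<in> ?B. J [^] m \<otimes> emb (l m))" "b = (\<Oplus> m \<in> ?B. J [^] m \<otimes> emb (l' m))"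
    using nf normal_form_superset[of l ?B a] normal_form_superset[of l' ?B b] L B by auto
  have "(\<Oplus> m \<in> ?B. J [^] m \<otimes> emb (\<lambda>p. l m p + l' m p)) =
      (\<Oplus> m \<in> ?B. J [^] m \<otimes> emb (l m) \<oplus> J [^] m \<otimes> emb (l' m))"
    by (rule finsum_cong') (auto simp: emb_add L r_distr J_closed)
  also have "\<dots> = a \<oplus> b"
    unfolding a by (rule finsum_addf) (auto simp: L J_closed)
  finally have ab: "a \<oplus> b = (\<Oplus> m \<in> ?B. J [^] m \<otimes> emb (\<lambda>p. l m p + l' m p))" ..
  have "pairing H lam J emb (a \<oplus> b) f = (\<Sum>m\<in>?B. pair_term f m (\<lambda>p. l m p + l' m p))"
    unfolding ab by (rule pairing_eq_sum) (use L B in \<open>auto intro: Lset.add\<close>)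
  also have "\<dots> = (\<Sum>m\<in>?B. pair_term f m (l m)) + (\<Sum>m\<in>?B. pair_term f m (l' m))"
    by (simp add: pair_term_add[OF L] sum.distrib)
  also have "(\<Sum>m\<in>?B. pair_term f m (l m)) = pairing H lam J emb a f"
    unfolding a by (rule pairing_eq_sum[symmetric]) (use L B in auto)
  also have "(\<Sum>m\<in>?B. pair_term f m (l' m)) = pairing H lam J emb b f"
    unfolding a by (rule pairing_eq_sum[symmetric]) (use L B in auto)
  finally show ?thesis .
qed

text \<open>The commutation relation gives \<open>l J\<^sup>m = \<Sum>\<^sub>k (m choose k) J\<^sup>m\<^sup>-\<^sup>k Jhat\<^sup>k l\<close>.\<close>

lemma pairing_emb_monomial:
  assumes "l \<in> Lset lam" "l' \<in> Lset lam"
  shows "pairing H lam J emb (J [^] (a::nat) \<otimes> (emb l \<otimes> (J [^] (m::nat) \<otimes> emb l'))) f =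
    (\<Sum>k\<le>m. of_nat (m choose k) * pair_term f (a + m - k) (\<lambda>p. (Jhat lam om ^^ k) l p * l' p))"
  using assms(1)
proof (induction m arbitrary: a l)
  case 0
  thus ?case using assms
    by (simp add: J_closed emb_mult[symmetric] pairing_monomial Lset.mult)
next
  case (Suc m)
  let ?G = "\<lambda>b k. pair_term f b (\<lambda>p. (Jhat lam om ^^ k) l p * l' p)"
  \<comment> \<open>One J is moved past l. In one summand it joins the left power J^a, in the other
    l is replaced by \<open>Jhat lam om l\<close>; hence both a and l vary in the induction.\<close>
  have "emb l \<otimes> (J [^] Suc m \<otimes> emb l') = (emb l \<otimes> J) \<otimes> (J [^] m \<otimes> emb l')"
    unfolding nat_pow_Suc2[OF J_closed] using Suc.prems assms by (simp add: J_closed m_assoc)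
  also have "\<dots> = J \<otimes> (emb l \<otimes> (J [^] m \<otimes> emb l')) \<oplus> emb (Jhat lam om l) \<otimes> (J [^] m \<otimes> emb l')"
    using Suc.prems assms by (simp add: comm l_distr m_assoc J_closed Jhat_closed)
  finally have *: "J [^] a \<otimes> (emb l \<otimes> (J [^] Suc m \<otimes> emb l')) =
     J [^] Suc a \<otimes> (emb l \<otimes> (J [^] m \<otimes> emb l')) \<oplus> J [^] a \<otimes> (emb (Jhat lam om l) \<otimes> (J [^] m \<otimes> emb l'))"
    using Suc.prems assms by (simp add: r_distr m_assoc J_closed Jhat_closed)
  have "pairing H lam J emb (J [^] a \<otimes> (emb l \<otimes> (J [^] Suc m \<otimes> emb l'))) f =
      (\<Sum>k\<le>m. of_nat (m choose k) * ?G (Suc a + m - k) k) +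
      (\<Sum>k\<le>m. of_nat (m choose k) * ?G (a + m - k) (Suc k))"
    unfolding * using Suc.prems assms Suc.IH[of l "Suc a"] Suc.IH[OF Jhat_closed[OF Suc.prems, of om], of a]
    by (subst pairing_add) (simp_all add: J_closed Jhat_closed funpow_swap1 del: nat_pow_Suc)
  \<comment> \<open>The added term has binomial coefficient zero; splitting off k = 0 then prepares
    Pascal's rule.\<close>
  also have "(\<Sum>k\<le>m. of_nat (m choose k) * ?G (Suc a + m - k) k) =
      (\<Sum>k\<le>Suc m. of_nat (m choose k) * ?G (Suc a + m - k) k)"
    by simp
  also have "\<dots> = ?G (Suc a + m) 0 + (\<Sum>k\<le>m. of_nat (m choose Suc k) * ?G (a + m - k) (Suc k))"
    by (subst sum.atMost_Suc_shift) simp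
  also have "\<dots> + (\<Sum>k\<le>m. of_nat (m choose k) * ?G (a + m - k) (Suc k)) =
      ?G (a + Suc m) 0 + (\<Sum>k\<le>m. of_nat (Suc m choose Suc k) * ?G (a + Suc m - Suc k) (Suc k))"
    by (simp add: sum.distrib[symmetric] algebra_simps)
  also have "\<dots> = (\<Sum>k\<le>Suc m. of_nat (Suc m choose k) * ?G (a + Suc m - k) k)"
    unfolding sum.atMost_Suc_shift[where n = m] by simp
  finally show ?case .
qed

end

section \<open>Operators on the coefficients of elements of F\<close>

lemma coeff_d_phi: "coeff (coeff (d_phi f) s) r = fps_deriv (coeff (coeff f s) r)"
  by (simp add: d_phi_def coeff_map_poly)

lemma coeff_d_a1: "coeff (coeff (d_a1 f) s) r = of_nat (Suc r) * coeff (coeff f s) (Suc r)"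
  by (simp add: d_a1_def coeff_map_poly coeff_pderiv)

lemma coeff_d_a2: "coeff (coeff (d_a2 f) s) r = of_nat (Suc s) * coeff (coeff f (Suc s)) r"
  unfolding d_a2_def coeff_pderiv of_nat_poly by (simp del: of_nat_Suc)

lemma fps_of_nat_mult_nth: "(of_nat n * F) $ m = (of_nat n :: 'a::comm_semiring_1) * F $ m"
  by (simp add: fps_of_nat[symmetric])

text \<open>On coefficients weighted by r!, differentiation is a pure shift.\<close>

lemma coeff_d_a1_pow:
  "fact r * (coeff (coeff ((d_a1 ^^ i) f) s) r $ m) = fact (r + i) * (coeff (coeff f s) (r + i) $ m)"
proof (induction i arbitrary: r)
  case (Suc i)
  show ?case using Suc.IH[of "Suc r"]
    by (simp add: coeff_d_a1 fps_of_nat_mult_nth algebra_simps del: of_nat_Suc)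
qed simp

lemma coeff_d_a2_pow:
  "fact s * (coeff (coeff ((d_a2 ^^ j) f) s) r $ m) = fact (s + j) * (coeff (coeff f (s + j)) r $ m)"
proof (induction j arbitrary: s)
  case (Suc j)
  show ?case using Suc.IH[of "Suc s"]
    by (simp add: coeff_d_a2 fps_of_nat_mult_nth algebra_simps del: of_nat_Suc)
qed simp

lemma coeff_d_a12_pow:
  "fact s * (fact r * (coeff (coeff ((d_a1 ^^ i) ((d_a2 ^^ j) f)) s) r $ m)) =
     fact (s + j) * (fact (r + i) * (coeff (coeff f (s + j)) (r + i) $ m))"
  by (metis coeff_d_a1_pow coeff_d_a2_pow mult.left_commute)

lemma d_a12_pow_eq_0:
  assumes "coeffs_within N f" "i > N \<or> j > N"
  shows "(d_a1 ^^ i) ((d_a2 ^^ j) f) = 0"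
proof (intro poly_eqI fps_ext)
  fix s r m
  have "coeff (coeff f (s + j)) (r + i) = 0" using assms by (auto simp: coeffs_within_def)
  thus "coeff (coeff ((d_a1 ^^ i) ((d_a2 ^^ j) f)) s) r $ m = coeff (coeff 0 s) r $ m"
    using coeff_d_a12_pow[of s r i j f m] by simp
qed

lemma act_eq_sum:
  assumes "coeffs_within N f"
  shows "act T f = (\<Sum>j\<le>N. \<Sum>i\<le>N. smult [:T $ j $ i:] ((d_a1 ^^ i) ((d_a2 ^^ j) f)))"
proof -
  have "act T f = (\<Sum>(i, j)\<in>{..N} \<times> {..N}. smult [:T $ j $ i:] ((d_a1 ^^ i) ((d_a2 ^^ j) f)))"
    unfolding act_def using d_a12_pow_eq_0[OF assms]
    by (intro sum.mono_neutral_left) (auto simp: not_le[symmetric])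
  also have "\<dots> = (\<Sum>i\<le>N. \<Sum>j\<le>N. smult [:T $ j $ i:] ((d_a1 ^^ i) ((d_a2 ^^ j) f)))"
    by (simp add: sum.cartesian_product)
  finally show ?thesis by (subst sum.swap)
qed

text \<open>In the weighted coefficients the operator is a correlation with T in the indices of a1
  and a2, and a convolution in the index of phi.\<close>

lemma coeff_act:
  assumes "coeffs_within N f"
  shows "fact s * (fact r * (coeff (coeff (act T f) s) r $ m)) =
    (\<Sum>j\<le>N. \<Sum>i\<le>N. \<Sum>k\<le>m. T $ j $ i $ k *
       (fact (s + j) * (fact (r + i) * (coeff (coeff f (s + j)) (r + i) $ (m - k)))))"
  unfolding act_eq_sum[OF assms] coeff_d_a12_pow[symmetric]
  by (simp add: coeff_sum fps_sum_nth fps_mult_nth sum_distrib_left atMost_atLeast0 mult.left_commute)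

lemma coeffs_within_act:
  assumes "coeffs_within N f"
  shows "coeffs_within N (act T f)"
  unfolding coeffs_within_def
proof (intro allI impI fps_ext)
  fix s r m assume *: "s > N \<or> r > N"
  have "coeff (coeff f (s + j)) (r + i) = 0" for i j using * assms by (auto simp: coeffs_within_def)
  hence "fact s * (fact r * (coeff (coeff (act T f) s) r $ m)) = 0"
    unfolding coeff_act[OF assms] by simp
  thus "coeff (coeff (act T f) s) r $ m = 0 $ m" by simp
qed

text \<open>The substitution t = s - j makes the indices independent; this moves shifts from Taylor
  coefficients to the coefficients of f.\<close>

lemma sum_convolution:
  fixes g :: "nat \<Rightarrow> nat \<Rightarrow> 'a::comm_monoid_add"
  assumes "\<And>j t. j + t > N \<Longrightarrow> g j t = 0"
  shows "(\<Sum>s\<le>N. \<Sum>j=0..s. g j (s - j)) = (\<Sum>j\<le>N. \<Sum>t\<le>N. g j t)"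
proof -
  have "(\<Sum>j\<le>N. \<Sum>t\<le>N. g j t) = (\<Sum>(j, t)\<in>{..N} \<times> {..N}. g j t)"
    by (rule sum.cartesian_product)
  also have "\<dots> = (\<Sum>(j, t)\<in>{(j, t). j + t \<le> N}. g j t)"
  proof -
    have "g j t \<noteq> 0 \<Longrightarrow> j + t \<le> N" for j t using assms not_le by blast
    thus ?thesis by (intro sum.mono_neutral_right) auto
  qed
  finally show ?thesis by (simp add: sum.triangle_reindex_eq atMost_atLeast0)
qed

text \<open>The right side is the expansion in \<open>pairing_emb_monomial\<close> with a = 0, so
  \<open>act\<close> of the flow is adjoint to left multiplication by l. Multiplication by phi^k
  lowers the power of J from m to m - k.\<close>

lemma pair_term_act:
  assumes "l \<in> Lset lam" "l' \<in> Lset lam"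
  shows "pair_term (act (flow lam om l) f) m l' =
    (\<Sum>k\<le>m. of_nat (m choose k) * pair_term f (m - k) (\<lambda>p. (Jhat lam om ^^ k) l p * l' p))"
proof -
  interpret dJ: derivation lam "Jhat lam om" by (rule derivation_Jhat)
  obtain N where N: "coeffs_within N f" using ex_coeffs_within by blast
  define c where "c = (\<lambda>k s r. fact s * (fact r * (coeff (coeff f s) r $ k)))"
  have c0: "c k s r = 0" if "s > N \<or> r > N" for k s r
    using N that by (auto simp: c_def coeffs_within_def)
  define T where "T = (\<lambda>k j i. flow lam om l $ j $ i $ k)"
  define t where "t = (\<lambda>s r. taylor l' $ s $ r)"
  \<comment> \<open>The factor k! undoes the division in the divided powers of
    \<open>Jhat\<close>.\<close>
  have tay: "taylor (\<lambda>p. (Jhat lam om ^^ k) l p * l' p) $ s $ r =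
      fact k * (\<Sum>j=0..s. \<Sum>i=0..r. T k j i * t (s - j) (r - i))" for k s r
  proof -
    have "taylor (\<lambda>p. (Jhat lam om ^^ k) l p) = taylor (\<lambda>p. fact k * dJ.dpow k l p)"
      by (simp add: dJ.dpow_def)
    also have "\<dots> = fps_const (fps_const (fact k)) * taylor (dJ.dpow k l)"
      by (simp only: taylor_mult[OF Lset.const dJ.dpow_closed[OF assms(1)]] taylor_const)
    finally show ?thesis
      by (simp add: taylor_mult[OF dJ.funpow_closed assms(2)] assms mult.assoc)
         (simp add: fps2_mult_nth T_def t_def flow_nth)
  qed
  \<comment> \<open>The convolution of Taylor coefficients is transposed into a correlation acting
    on f; \<open>c0\<close> removes the terms beyond N.\<close>
  have conv: "(\<Sum>s\<le>N. \<Sum>r\<le>N. c k s r * (\<Sum>j=0..s. \<Sum>i=0..r. T k' j i * t (s - j) (r - i))) =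
     (\<Sum>s\<le>N. \<Sum>r\<le>N. (\<Sum>j\<le>N. \<Sum>i\<le>N. T k' j i * c k (s + j) (r + i)) * t s r)" for k k'
  proof -
    define G where "G = (\<lambda>j s i r. T k' j i * c k (s + j) (r + i) * t s r)"
    have "(\<Sum>s\<le>N. \<Sum>r\<le>N. c k s r * (\<Sum>j=0..s. \<Sum>i=0..r. T k' j i * t (s - j) (r - i))) =
      (\<Sum>s\<le>N. \<Sum>r\<le>N. \<Sum>j=0..s. \<Sum>i=0..r. G j (s - j) i (r - i))"
      unfolding sum_distrib_left by (intro sum.cong refl) (simp add: G_def)
    also have "\<dots> = (\<Sum>s\<le>N. \<Sum>j=0..s. \<Sum>r\<le>N. \<Sum>i=0..r. G j (s - j) i (r - i))"
      by (intro sum.cong refl sum.swap)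
    also have "\<dots> = (\<Sum>j\<le>N. \<Sum>s\<le>N. \<Sum>r\<le>N. \<Sum>i=0..r. G j s i (r - i))"
      by (rule sum_convolution) (simp add: G_def c0)
    also have "\<dots> = (\<Sum>j\<le>N. \<Sum>s\<le>N. \<Sum>i\<le>N. \<Sum>r\<le>N. G j s i r)"
      by (intro sum.cong refl sum_convolution) (simp add: G_def c0)
    also have "\<dots> = (\<Sum>s\<le>N. \<Sum>j\<le>N. \<Sum>i\<le>N. \<Sum>r\<le>N. G j s i r)"
      by (rule sum.swap)
    also have "\<dots> = (\<Sum>s\<le>N. \<Sum>j\<le>N. \<Sum>r\<le>N. \<Sum>i\<le>N. G j s i r)"
      by (intro sum.cong refl sum.swap)
    also have "\<dots> = (\<Sum>s\<le>N. \<Sum>r\<le>N. \<Sum>j\<le>N. \<Sum>i\<le>N. G j s i r)"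
      by (intro sum.cong refl sum.swap)
    finally show ?thesis by (simp add: G_def sum_distrib_right)
  qed
  have "pair_term (act (flow lam om l) f) m l' =
     fact m * (\<Sum>s\<le>N. \<Sum>r\<le>N. (\<Sum>j\<le>N. \<Sum>i\<le>N. \<Sum>k\<le>m. T k j i * c (m - k) (s + j) (r + i)) * t s r)"
    unfolding pair_term_taylor[OF assms(2) coeffs_within_act[OF N]] coeff_act[OF N]
    by (simp add: T_def c_def t_def)
  also have "(\<Sum>s\<le>N. \<Sum>r\<le>N. (\<Sum>j\<le>N. \<Sum>i\<le>N. \<Sum>k\<le>m. T k j i * c (m - k) (s + j) (r + i)) * t s r)
      = (\<Sum>s\<le>N. \<Sum>r\<le>N. \<Sum>k\<le>m. (\<Sum>j\<le>N. \<Sum>i\<le>N. T k j i * c (m - k) (s + j) (r + i)) * t s r)"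
  proof (intro sum.cong refl)
    fix s r
    have "(\<Sum>j\<le>N. \<Sum>i\<le>N. \<Sum>k\<le>m. T k j i * c (m - k) (s + j) (r + i)) =
       (\<Sum>j\<le>N. \<Sum>k\<le>m. \<Sum>i\<le>N. T k j i * c (m - k) (s + j) (r + i))"
      by (intro sum.cong refl sum.swap)
    also have "\<dots> = (\<Sum>k\<le>m. \<Sum>j\<le>N. \<Sum>i\<le>N. T k j i * c (m - k) (s + j) (r + i))"
      by (rule sum.swap)
    finally show "(\<Sum>j\<le>N. \<Sum>i\<le>N. \<Sum>k\<le>m. T k j i * c (m - k) (s + j) (r + i)) * t s r =
       (\<Sum>k\<le>m. (\<Sum>j\<le>N. \<Sum>i\<le>N. T k j i * c (m - k) (s + j) (r + i)) * t s r)"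
      by (simp only: sum_distrib_right)
  qed
  also have "\<dots> = (\<Sum>s\<le>N. \<Sum>k\<le>m. \<Sum>r\<le>N. (\<Sum>j\<le>N. \<Sum>i\<le>N. T k j i * c (m - k) (s + j) (r + i)) * t s r)"
    by (intro sum.cong refl sum.swap)
  also have "\<dots> = (\<Sum>k\<le>m. \<Sum>s\<le>N. \<Sum>r\<le>N. (\<Sum>j\<le>N. \<Sum>i\<le>N. T k j i * c (m - k) (s + j) (r + i)) * t s r)"
    by (rule sum.swap)
  also have "fact m * \<dots> = (\<Sum>k\<le>m. of_nat (m choose k) *
      pair_term f (m - k) (\<lambda>p. (Jhat lam om ^^ k) l p * l' p))"
  proof (subst sum_distrib_left, intro sum.cong refl)
    \<comment> \<open>The identity (m choose k) (m-k)! k! = m! absorbs the factorials of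
      \<open>pair_term\<close> and of the powers of \<open>Jhat\<close>.\<close>
    fix k assume "k \<in> {..m}"
    hence "of_nat (m choose k) * fact (m - k) * fact k = (fact m :: complex)"
      by (subst binomial_fact) auto
    moreover have "pair_term f (m - k) (\<lambda>p. (Jhat lam om ^^ k) l p * l' p) = fact (m - k) * (fact k *
       (\<Sum>s\<le>N. \<Sum>r\<le>N. c (m - k) s r * (\<Sum>j=0..s. \<Sum>i=0..r. T k j i * t (s - j) (r - i))))"
      unfolding pair_term_taylor[OF Lset.mult[OF dJ.funpow_closed[OF assms(1)] assms(2)] N] tay
        sum_distrib_left[of "fact k"] mult.left_commute[of "fact k"] c_def ..
    ultimately show "fact m * (\<Sum>s\<le>N. \<Sum>r\<le>N. (\<Sum>j\<le>N. \<Sum>i\<le>N. T k j i * c (m - k) (s + j) (r + i)) * t s r) =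
      of_nat (m choose k) * pair_term f (m - k) (\<lambda>p. (Jhat lam om ^^ k) l p * l' p)"
      unfolding conv[symmetric] by (simp only: mult.assoc[symmetric])
  qed
  finally show ?thesis .
qed

text \<open>The factor m+1 from differentiating phi^(m+1) completes m! to (m+1)!.\<close>

lemma pair_term_d_phi:
  assumes "l \<in> Lset lam"
  shows "pair_term (d_phi f) m l = pair_term f (Suc m) l"
proof -
  obtain N where N: "coeffs_within N f" using ex_coeffs_within by blast
  hence "coeffs_within N (d_phi f)" by (simp add: coeffs_within_def coeff_d_phi)
  from pair_term_taylor[OF assms this] pair_term_taylor[OF assms N] show ?thesis
    by (simp add: coeff_d_phi sum_distrib_left algebra_simps)
qed

lemma pair_term_monomial:
  fixes r s :: nat
  defines "l \<equiv> (\<lambda>p. of_real (fst p) ^ r * of_real (snd p) ^ s)"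
  shows "l \<in> Lset lam"
    and "pair_term f m l = fact m * (fact s * (fact r * (coeff (coeff f s) r $ m)))"
proof -
  show l: "l \<in> Lset lam" for lam
    unfolding l_def by (intro Lset.mult taylor_power Lset.P1 Lset.P2)
  have tay: "taylor l $ s' $ r' = (if r' = r then if s' = s then 1 else 0 else 0)" for s' r'
    unfolding l_def
    \<comment> \<open>Monomials lie in every \<open>Lset\<close>, and \<open>taylor\<close> does not
      mention the parameter, so it may be set to 0.\<close>
    by (subst taylor_mult[of _ 0], (intro taylor_power Lset.P1 Lset.P2)+,
        subst taylor_power[OF Lset.P1], subst taylor_power[OF Lset.P2])
       (simp add: taylor_fst taylor_snd fps_const_power)
  obtain N where N: "coeffs_within N f" using ex_coeffs_within by blast
  \<comment> \<open>The square is enlarged to contain r and s, so that the one surviving term is in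
    range.\<close>
  have N': "coeffs_within (max N (max r s)) f" using N by (rule coeffs_within_mono) simp
  show "pair_term f m l = fact m * (fact s * (fact r * (coeff (coeff f s) r $ m)))"
    unfolding pair_term_taylor[OF l N'] tay
    by (simp add: if_distrib[of "\<lambda>x. _ * x"] le_max_iff_disj cong: if_cong)
qed

section \<open>Nondegeneracy and the right regular action\<close>

context U_iso2
begin

text \<open>Testing on J^m P1^r P2^s reads off each coefficient. This is the uniqueness behind the
  description in \<open>right_regular\<close>.\<close>

lemma pairing_nondegenerate:
  assumes "\<And>h. h \<in> carrier H \<Longrightarrow> pairing H lam J emb h f = pairing H lam J emb h g"
  shows "f = g"
proof (intro poly_eqI fps_ext)
  fix s r m
  let ?l = "\<lambda>p. of_real (fst p) ^ r * of_real (snd p) ^ s"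
  have "pairing H lam J emb (J [^] m \<otimes> emb ?l) f = pairing H lam J emb (J [^] (m::nat) \<otimes> emb ?l) g"
    by (intro assms m_closed nat_pow_closed J_closed emb_closed pair_term_monomial(1))
  thus "coeff (coeff f s) r $ m = coeff (coeff g s) r $ m"
    by (simp add: pairing_monomial pair_term_monomial)
qed

text \<open>The pairing is additive in its algebra argument, so it suffices to check monomials;
  uniqueness is nondegeneracy.\<close>

lemma right_regular_eqI:
  assumes "h \<in> carrier H"
    and "\<And>m l. l \<in> Lset lam \<Longrightarrow>
      pairing H lam J emb (h \<otimes> (J [^] (m::nat) \<otimes> emb l)) f = pair_term g m l"
  shows "right_regular H lam J emb f h = g"
proof -
  have "pairing H lam J emb h' g = pairing H lam J emb (h \<otimes> h') f" if "h' \<in> carrier H" for h'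
    using carrier_Aset[OF that]
  proof induction
    case (base l m)
    thus ?case by (simp add: assms pairing_monomial)
  next
    case (add a b)
    thus ?case using assms(1) by (simp add: pairing_add r_distr Aset_closed)
  qed
  thus ?thesis unfolding right_regular_def
    by (intro the_equality) (auto intro: pairing_nondegenerate)
qed

lemma right_regular_J: "right_regular H lam J emb f J = d_phi f"
proof (rule right_regular_eqI)
  fix m l assume l: "l \<in> Lset lam"
  have "J \<otimes> (J [^] m \<otimes> emb l) = J [^] Suc m \<otimes> emb l"
    unfolding nat_pow_Suc2[OF J_closed] using l by (simp add: J_closed m_assoc)
  thus "pairing H lam J emb (J \<otimes> (J [^] m \<otimes> emb l)) f = pair_term (d_phi f) m l"
    using l by (simp only: pairing_monomial pair_term_d_phi)
qed (rule J_closed)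

lemma right_regular_emb:
  assumes "l \<in> Lset lam"
  shows "right_regular H lam J emb f (emb l) = act (flow lam om l) f"
proof (rule right_regular_eqI)
  fix m l' assume l': "l' \<in> Lset lam"
  show "pairing H lam J emb (emb l \<otimes> (J [^] m \<otimes> emb l')) f = pair_term (act (flow lam om l) f) m l'"
    using pairing_emb_monomial[OF assms l', of 0 m f] pair_term_act[OF assms l', of om f m] assms l'
    by (simp add: J_closed)
qed (simp add: assms)

end

section \<open>Power series in three variables\<close>

text \<open>\<open>series3\<close> is not a field; the halves in the formulas are eliminated through
  this relation.\<close>

lemma scal_half: "2 * scal (1 / 2) = 1"
  unfolding scal_simps(8)[symmetric] scal_simps(6)[symmetric] by (simp add: scal_simps(2))

lemma d_phi3_power: "d_phi3 (U ^ Suc n) = scal (of_nat (Suc n)) * U ^ n * d_phi3 U"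
proof (induction n)
  case (Suc n)
  have "d_phi3 (U ^ Suc (Suc n)) = U * d_phi3 (U ^ Suc n) + d_phi3 U * U ^ Suc n"
    by (subst power_Suc) (simp only: d_phi3_simps)
  thus ?case unfolding Suc.IH by (simp add: scal_simps algebra_simps)
qed (simp add: scal_simps)

lemma at_phi0_power: "at_phi0 (U ^ n) = at_phi0 U ^ n"
  by (induction n) (simp_all add: at_phi0_simps)

text \<open>In characteristic zero a vanishing derivative leaves only the coefficient of phi^0. Used
  for the first integral and for comparing antiderivatives.\<close>

lemma d_phi3_eq_0_imp:
  assumes "d_phi3 U = 0" "at_phi0 U = 0"
  shows "U = 0"
proof (intro fps_ext)
  fix s r q
  have "d_phi3 U $ s $ r $ (q - 1) = 0" "at_phi0 U $ s $ r $ 0 = 0" using assms by simp_all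
  thus "U $ s $ r $ q = 0 $ s $ r $ q"
    by (cases q) (auto simp: d_phi3_def at_phi0_def simp del: of_nat_Suc)
qed

text \<open>The coefficients at phi^(q+1) are determined by those at phi^q, so a zero initial value
  propagates.\<close>

lemma d_phi3_system_unique:
  assumes "d_phi3 U = scal a * V" "d_phi3 V = scal b * U" "at_phi0 U = 0" "at_phi0 V = 0"
  shows "U = 0 \<and> V = 0"
proof -
  have "U $ s $ r $ q = 0 \<and> V $ s $ r $ q = 0" for s r q
  proof (induction q)
    case 0
    have "at_phi0 U $ s $ r $ 0 = 0" "at_phi0 V $ s $ r $ 0 = 0" using assms by simp_all
    thus ?case by (simp add: at_phi0_def)
  next
    case (Suc q)
    have "d_phi3 U $ s $ r $ q = a * V $ s $ r $ q" "d_phi3 V $ s $ r $ q = b * U $ s $ r $ q"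
      using assms by (simp_all add: scal_mult_nth)
    thus ?case using Suc by (simp add: d_phi3_def del: of_nat_Suc)
  qed
  thus ?thesis by (simp add: fps_eq_iff)
qed

section \<open>Series in \<open>D2\<close> alone and substitution\<close>

definition const3 :: "complex fps \<Rightarrow> series3" where
  "const3 g = Abs_fps (\<lambda>s. fps_const (fps_const (g $ s)))"

lemma const3_nth: "const3 g $ s $ r $ q = (if r = 0 \<and> q = 0 then g $ s else 0)"
  by (auto simp: const3_def)

lemma const3_mult: "const3 (g * h) = const3 g * const3 h"
proof (intro fps_ext)
  fix s r q
  have "(const3 g * const3 h) $ s = fps_const (fps_const (\<Sum>j=0..s. g $ j * h $ (s - j)))"
  proof -
    have "(\<Sum>j\<in>A. fps_const (fps_const (k j))) = fps_const (fps_const (\<Sum>j\<in>A. k j))"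
      for k :: "nat \<Rightarrow> complex" and A
      by (induction A rule: infinite_finite_induct) simp_all
    thus ?thesis by (simp add: fps_mult_nth const3_def)
  qed
  thus "const3 (g * h) $ s $ r $ q = (const3 g * const3 h) $ s $ r $ q"
    by (simp add: const3_def fps_mult_nth)
qed

lemma const3_diff: "const3 (g - h) = const3 g - const3 h"
  and const3_1: "const3 1 = 1"
  by (auto simp: fps_eq_iff const3_nth)

lemma const3_power: "const3 (g ^ n) = const3 g ^ n"
  by (induction n) (simp_all add: const3_1 const3_mult)

lemma scal_D2: "scal c * D2 = const3 (fps_const c * fps_X)"
  by (auto simp: fps_eq_iff const3_nth scal_mult_nth D2_def fps_X_def)

text \<open>\<open>const3\<close> embeds univariate series along \<open>D2\<close>. Only r = q = 0
  contributes, where the truncation in \<open>subst3\<close> is that of ordinary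
  composition.\<close>

lemma subst3_const3: "subst3 a (const3 g) = const3 (a oo g)"
  by (auto simp: fps_eq_iff subst3_def const3_power[symmetric] const3_nth fps_compose_nth atMost_atLeast0)

lemma subst3_Phi: "subst3 a Phi = fps_const (fps_const a)"
  by (auto simp: fps_eq_iff subst3_def Phi_def fps_const_power fps_X_power_nth if_distrib[of "\<lambda>x. _ * x"]
      cong: if_cong)

lemma exp3_D2: "exp3 (scal c * D2) = const3 (fps_exp c)"
  unfolding exp3_def scal_D2 subst3_const3
  by (simp add: fps_compose_linear fps_eq_iff const3_nth)

lemma exp3_minus_D2: "exp3 (- (scal c * D2)) = const3 (fps_exp (- c))"
  using exp3_D2[of "- c"] by (simp add: scal_simps)

lemma at_phi0_const3: "at_phi0 (const3 g) = const3 g"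
  and d_phi3_const3: "d_phi3 (const3 g) = 0"
  by (auto simp: fps_eq_iff at_phi0_def d_phi3_def const3_nth)

lemma at_phi0_subst3: "at_phi0 (subst3 a u) = subst3 a (at_phi0 u)"
proof (intro fps_ext)
  fix s r q
  have "at_phi0 (u ^ k) $ s $ r $ q = (if q = 0 then u ^ k $ s $ r $ 0 else 0)" for k
    by (simp add: at_phi0_def)
  thus "at_phi0 (subst3 a u) $ s $ r $ q = subst3 a (at_phi0 u) $ s $ r $ q"
    by (simp add: subst3_def at_phi0_power[symmetric]) (simp add: at_phi0_def)
qed

text \<open>\<open>fps_ln 1\<close> is the series of ln(1 + x); both sides have derivative c and
  constant term 0. Gives the value of the logarithm at phi = 0.\<close>

lemma fps_ln_compose_exp: "fps_ln 1 oo (fps_exp c - 1) = fps_const c * fps_X" for c :: complex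
proof -
  let ?g = "fps_exp c - 1"
  have "fps_deriv (fps_ln 1 oo ?g) = (inverse (1 + fps_X) oo ?g) * fps_deriv ?g"
    by (simp add: fps_compose_deriv fps_ln_deriv)
  also have "inverse (1 + fps_X) oo ?g = inverse ((1 + fps_X) oo ?g)"
    by (rule fps_inverse_compose) simp_all
  also have "(1 + fps_X) oo ?g = fps_exp c"
    by (simp add: fps_compose_add_distrib)
  also have "inverse (fps_exp c) * fps_deriv ?g = fps_const c"
    by (simp add: fps_exp_neg[symmetric] fps_exp_add_mult[symmetric] mult.left_commute)
  finally have "fps_deriv (fps_ln 1 oo ?g) = fps_deriv (fps_const c * fps_X)" by simp
  thus ?thesis by (subst (asm) fps_deriv_eq_iff) (simp add: fps_ln_def)
qed

section \<open>Order in total degree and the derivative of the logarithm\<close>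

definition vanishes :: "nat \<Rightarrow> series3 \<Rightarrow> bool" where
  "vanishes n U \<longleftrightarrow> (\<forall>s r q. s + r + q < n \<longrightarrow> U $ s $ r $ q = 0)"

lemma vanishes_mult:
  assumes "vanishes a U" "vanishes b V"
  shows "vanishes (a + b) (U * V)"
  unfolding vanishes_def
proof (intro allI impI)
  fix s r q assume n: "s + r + q < a + b"
  have "U $ j $ i $ k * V $ (s - j) $ (r - i) $ (q - k) = 0"
    if "j \<le> s" "i \<le> r" "k \<le> q" for i j k
  proof (cases "j + i + k < a")
    case False
    hence "(s - j) + (r - i) + (q - k) < b" using n that by linarith
    thus ?thesis using assms(2) by (simp add: vanishes_def)
  qed (use assms(1) in \<open>simp add: vanishes_def\<close>)
  thus "(U * V) $ s $ r $ q = 0"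
    by (simp add: fps2_mult_nth fps_sum_nth fps_mult_nth sum.neutral)
qed

lemma vanishes_0: "vanishes 0 U"
  by (simp add: vanishes_def)

lemma vanishes_power: "vanishes 1 u \<Longrightarrow> vanishes n (u ^ n)"
  by (induction n) (use vanishes_mult[of 1 u] in \<open>auto simp: vanishes_0\<close>)

lemma vanishes_diff: "vanishes n U \<Longrightarrow> vanishes n V \<Longrightarrow> vanishes n (U - V)"
  by (simp add: vanishes_def)

lemma vanishes_d_phi3: "vanishes (Suc n) U \<Longrightarrow> vanishes n (d_phi3 U)"
  by (simp add: vanishes_def d_phi3_def)

text \<open>The k-th power of u has total degree at least k, so \<open>subst3\<close> agrees with a
  polynomial in u up to any given order.\<close>

lemma vanishes_subst3:
  assumes "u $ 0 $ 0 $ 0 = 0"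
  shows "vanishes (Suc n) (subst3 a u - (\<Sum>k\<le>n. scal (a $ k) * u ^ k))"
  unfolding vanishes_def
proof (intro allI impI)
  fix s r q assume n: "s + r + q < Suc n"
  have "vanishes 1 u" using assms by (simp add: vanishes_def)
  hence "u ^ k $ s $ r $ q = 0" if "s + r + q < k" for k
    using vanishes_power[of u k] that by (simp add: vanishes_def)
  hence "(\<Sum>k\<le>q + r + s. a $ k * u ^ k $ s $ r $ q) = (\<Sum>k\<le>n. a $ k * u ^ k $ s $ r $ q)"
    using n by (intro sum.mono_neutral_left) auto
  thus "(subst3 a u - (\<Sum>k\<le>n. scal (a $ k) * u ^ k)) $ s $ r $ q = 0"
    by (simp add: subst3_def fps_sum_nth scal_mult_nth)
qed

text \<open>Partial sums of the logarithm satisfy the identity up to a geometric remainder; the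
  error has arbitrarily high order and hence vanishes.\<close>

lemma d_phi3_ln3:
  assumes "U $ 0 $ 0 $ 0 = 1"
  shows "d_phi3 (ln3 U) * U = d_phi3 U"
proof -
  define u where "u = U - 1"
  have U: "U = 1 + u" by (simp add: u_def)
  have u0: "u $ 0 $ 0 $ 0 = 0" using assms by (simp add: u_def)
  define P where "P = (\<lambda>n. \<Sum>k\<le>n. scal (fps_ln 1 $ k) * u ^ k)"
  \<comment> \<open>The derivative of \<open>P n\<close> is a geometric sum in -u times that of u,
    and telescopes after multiplication by U = 1 + u.\<close>
  have P: "d_phi3 (P n) * U = d_phi3 u * (1 - (- u) ^ n)" for n
  proof (induction n)
    case 0
    have "P 0 = scal 0" by (simp add: P_def fps_ln_def scal_simps)
    thus ?case by (simp only: d_phi3_simps) simp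
  next
    case (Suc n)
    have "P (Suc n) = P n + scal ((- 1) ^ n / of_nat (Suc n)) * u ^ Suc n"
      by (simp add: P_def fps_ln_def)
    hence "d_phi3 (P (Suc n)) = d_phi3 (P n) +
        (scal ((- 1) ^ n / of_nat (Suc n)) * scal (of_nat (Suc n))) * u ^ n * d_phi3 u"
      by (simp only: d_phi3_simps d_phi3_power) (simp add: mult.assoc)
    also have "scal ((- 1) ^ n / of_nat (Suc n)) * scal (of_nat (Suc n)) = (- 1) ^ n"
      unfolding scal_simps(6)[symmetric] by (simp add: scal_simps del: of_nat_Suc)
    finally have "d_phi3 (P (Suc n)) * U = d_phi3 (P n) * U + (- u) ^ n * d_phi3 u * U"
      by (simp add: algebra_simps power_minus[of u])
    thus ?case unfolding Suc.IH by (simp add: U algebra_simps)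
  qed
  have "vanishes n (d_phi3 (ln3 U) * U - d_phi3 U)" for n
  proof -
    \<comment> \<open>Differentiation costs one degree, so the truncation error of order n+1 leaves
      order n.\<close>
    have "vanishes n (d_phi3 (ln3 U - P n) * U)"
      using vanishes_mult[OF vanishes_d_phi3[OF vanishes_subst3[OF u0]] vanishes_0]
      by (simp add: ln3_def P_def u_def)
    moreover have "vanishes 1 (- u)" using u0 by (simp add: vanishes_def)
    hence "vanishes n ((- u) ^ n * d_phi3 u)"
      using vanishes_mult[OF vanishes_power vanishes_0] by fastforce
    ultimately have "vanishes n (d_phi3 (ln3 U - P n) * U - (- u) ^ n * d_phi3 u)"
      by (rule vanishes_diff)
    also have "d_phi3 (ln3 U - P n) * U - (- u) ^ n * d_phi3 u = d_phi3 (ln3 U) * U - d_phi3 u"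
      using P[of n] by (simp add: d_phi3_simps algebra_simps)
    also have "d_phi3 u = d_phi3 U"
      using d_phi3_simps(4)[of 1] by (simp add: u_def d_phi3_simps(2) scal_simps)
    finally show ?thesis .
  qed
  hence "(d_phi3 (ln3 U) * U - d_phi3 U) $ s $ r $ q = 0" for s r q
    by (auto simp only: vanishes_def)
  hence "d_phi3 (ln3 U) * U - d_phi3 U = 0" by (simp only: fps_eq_iff fps_zero_nth) simp
  thus ?thesis by simp
qed

text \<open>Later proofs use C and S only through this initial value problem, which treats zero and
  nonzero omega alike; the exponential form enters through k^2 = -omega.\<close>

lemma C_om_S_om:
  "fps_deriv (C_om om) = - fps_const (of_real om) * S_om om" "fps_deriv (S_om om) = C_om om"
  "C_om om $ 0 = 1" "S_om om $ 0 = 0"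
proof -
  define k where "k = csqrt (of_real (- om))"
  have k: "k * k = - of_real om" unfolding k_def power2_eq_square[symmetric] power2_csqrt by simp
  hence om: "of_real om = - (k * k)" by simp
  have CS: "C_om om = fps_const (1 / 2) * (fps_exp k + fps_exp (- k))"
    "S_om om = fps_const (1 / (2 * k)) * (fps_exp k - fps_exp (- k))" "k \<noteq> 0" if "om \<noteq> 0"
    using that k by (auto simp: C_om_def S_om_def Let_def k_def)
  show "fps_deriv (C_om om) = - fps_const (of_real om) * S_om om"
  proof (cases "om = 0")
    case False
    show ?thesis using CS(3)[OF False]
      unfolding CS(1,2)[OF False] om by (simp add: fps_eq_iff field_simps)
  qed (simp add: C_om_def)
  show "fps_deriv (S_om om) = C_om om"
  proof (cases "om = 0")
    case False
    show ?thesis using CS(3)[OF False]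
      unfolding CS(1,2)[OF False] by (simp add: fps_eq_iff field_simps)
  qed (simp add: C_om_def S_om_def)
  show "C_om om $ 0 = 1" "S_om om $ 0 = 0"
    by (simp_all add: C_om_def S_om_def Let_def)
qed

section \<open>The flow of the generators\<close>

text \<open>\<open>E\<close> is the closed form for the flow G of exp(lam P2) and \<open>N\<close>
  the one for 2 lam X G, where X is the flow of P1; hence X = N / (2 lam E).\<close>

lemma flow_generators:
  fixes lam om :: real
  defines "la \<equiv> scal (of_real lam)" and "w \<equiv> scal (of_real om)"
    and "C \<equiv> subst3 (C_om om) Phi" and "S \<equiv> subst3 (S_om om) Phi"
  defines "e \<equiv> exp3 (la * D2)" and "ch \<equiv> cosh3 (la * D2)" and "sh \<equiv> sinh3 (la * D2)"
  defines "E \<equiv> ch + scal (1 / 2) * w * la\<^sup>2 * D1\<^sup>2 * e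
      + (sh - scal (1 / 2) * w * la\<^sup>2 * D1\<^sup>2 * e) * C + w * la * D1 * e * S"
    and "N \<equiv> 2 * la * D1 * e * C + (w * la\<^sup>2 * D1\<^sup>2 * e - 2 * sh) * S"
  assumes lam: "lam \<noteq> 0"
  shows "flow lam om (\<lambda>p. of_real (fst p)) = N * inverse (2 * la * E)"
    and "flow lam om (\<lambda>p. of_real (snd p)) = scal (1 / of_real lam) * ln3 E"
proof -
  let ?P1 = "\<lambda>p. of_real (fst p) :: complex" and ?P2 = "\<lambda>p. of_real (snd p) :: complex"
  let ?Ep = "\<lambda>p. exp (of_real (lam * snd p)) :: complex"
  let ?Em = "\<lambda>p. exp (of_real (- lam * snd p)) :: complex"
  define X where "X = flow lam om ?P1"
  define Y where "Y = flow lam om ?P2"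
  define G where "G = flow lam om ?Ep"
  define F where "F = flow lam om ?Em"
  define e' where "e' = exp3 (- (la * D2))"
  note L = Lset.P1[of lam] Lset.P2[of lam] Lset.exp_pos[of lam] Lset.exp_neg[of lam]
  note fl = flow_add flow_mult flow_const Lset.const Lset.mult Lset.add L
  \<comment> \<open>Taking the flow of exp(-lam P2) as a separate unknown keeps the equations
    polynomial.\<close>
  have GF: "G * F = 1"
  proof -
    have "(\<lambda>p. ?Ep p * ?Em p) = (\<lambda>p. 1)" by (simp flip: exp_add)
    from arg_cong[OF this, of "flow lam om"] show ?thesis
      unfolding G_def F_def by (simp only: flow_mult[OF L(3,4)] flow_const scal_simps)
  qed
  have dY: "d_phi3 Y = w * X"
  proof -
    have "Jhat lam om ?P2 = (\<lambda>p. of_real om * ?P1 p)" by (simp add: Jhat_def pd_snd)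
    thus ?thesis unfolding Y_def X_def w_def by (simp only: d_phi3_flow fl)
  qed
  have dG: "d_phi3 G = la * w * X * G"
  proof -
    have "Jhat lam om ?Ep = (\<lambda>p. of_real lam * of_real om * ?P1 p * ?Ep p)"
      unfolding Jhat_def pd_exp by (simp add: fun_eq_iff mult_ac)
    thus ?thesis unfolding G_def X_def w_def la_def
      by (simp only: d_phi3_flow fl scal_simps)
  qed
  have dF: "d_phi3 F = - (la * w * X * F)"
  proof -
    have "Jhat lam om ?Em = (\<lambda>p. - (of_real lam * of_real om) * ?P1 p * ?Em p)"
      unfolding Jhat_def pd_exp by (simp add: fun_eq_iff mult_ac)
    thus ?thesis unfolding F_def X_def w_def la_def
      by (simp only: d_phi3_flow fl scal_simps) simp
  qed
  \<comment> \<open>The factor 2 lam clears the quotient in \<open>Jhat\<close>.\<close>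
  have dX: "2 * la * d_phi3 X = F * F - 1 - la\<^sup>2 * w * X\<^sup>2"
  proof -
    have "of_real (exp (- 2 * lam * snd p)) = ?Em p * ?Em p" for p :: "real \<times> real"
      by (simp add: mult.assoc flip: exp_add exp_of_real)
    hence "(\<lambda>p. (2 * of_real lam) * Jhat lam om ?P1 p) =
        (\<lambda>p. ?Em p * ?Em p + (- 1 + - ((of_real lam)\<^sup>2 * of_real om) * (?P1 p * ?P1 p)))"
      using lam by (simp add: Jhat_def pd_fst fun_eq_iff field_simps power2_eq_square)
    from arg_cong[OF this, of "flow lam om"] show ?thesis
      unfolding F_def X_def w_def la_def
      by (simp only: d_phi3_flow[OF L(1)] fl Jhat_closed[OF L(1)] scal_simps) (simp add: power2_eq_square)
  qed
  have at0: "at_phi0 X = D1" "at_phi0 Y = D2"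
    unfolding X_def Y_def
    by (auto simp: fps_eq_iff at_phi0_flow taylor_fst taylor_snd D1_def D2_def fps_X_def)
  have at0_exp: "at_phi0 G = e" "at_phi0 F = e'"
    unfolding G_def F_def e_def e'_def la_def exp3_minus_D2 exp3_D2
    by (intro series3_eqI; unfold at_phi0_flow taylor_exp_nth[OF L(3)] taylor_exp_nth[OF L(4)];
        simp add: const3_def)+
  define h where "h = scal (1 / 2)"
  have h: "2 * h = 1" unfolding h_def by (rule scal_half)
  have ch: "2 * ch = e + e'" and sh: "2 * sh = e - e'"
    using h unfolding ch_def sh_def cosh3_def sinh3_def e_def e'_def h_def by (simp_all flip: mult.assoc)
  have dC: "d_phi3 C = - (w * S)" and dS: "d_phi3 S = C"
    unfolding C_def S_def w_def scal_def subst3_Phi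
    by (auto simp: fps_eq_iff d_phi3_def C_om_S_om simp del: fps_deriv_nth)
  have C0: "at_phi0 C = 1" and S0: "at_phi0 S = 0"
    unfolding C_def S_def subst3_Phi by (auto simp: fps_eq_iff at_phi0_def C_om_S_om)
  have de: "d_phi3 e = 0" "d_phi3 e' = 0" "at_phi0 e = e" "at_phi0 e' = e'"
    unfolding e_def e'_def la_def exp3_minus_D2 exp3_D2 by (simp_all add: d_phi3_const3 at_phi0_const3)
  have dch: "d_phi3 ch = 0" "d_phi3 sh = 0" "at_phi0 ch = ch" "at_phi0 sh = sh"
    unfolding ch_def sh_def cosh3_def sinh3_def e_def[symmetric] e'_def[symmetric]
    by (simp_all add: d_phi3_simps at_phi0_simps de)
  have d2: "d_phi3 2 = 0" "at_phi0 2 = 2"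
    using d_phi3_simps(4)[of 2] at_phi0_simps(4)[of 2] by (simp_all add: scal_simps)
  note d_simps = d_phi3_simps d2 dC dS de dch power2_eq_square la_def w_def h_def
  note at_simps = at_phi0_simps d2 C0 S0 de dch at0 at0_exp power2_eq_square la_def w_def h_def

  \<comment> \<open>The first integral that makes the equations for \<open>2 la X G\<close> and \<open>G\<close> linear.\<close>
  define K where "K = e + e' + w * la\<^sup>2 * D1\<^sup>2 * e"
  have "G + F + w * la\<^sup>2 * X\<^sup>2 * G - K = 0"
  proof (rule d_phi3_eq_0_imp)
    have "d_phi3 (G + F + w * la\<^sup>2 * X\<^sup>2 * G - K) =
        d_phi3 G + d_phi3 F + w * la\<^sup>2 * (2 * X * d_phi3 X * G + X\<^sup>2 * d_phi3 G)"
      unfolding K_def by (simp add: d_simps algebra_simps)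
    \<comment> \<open>Written as a combination of the equations \<open>dX\<close> and
      \<open>GF\<close>, so that both brackets are zero.\<close>
    also have "\<dots> = la * w * X * G * (2 * la * d_phi3 X - (F * F - 1 - la\<^sup>2 * w * X\<^sup>2))
        + la * w * X * F * (G * F - 1)"
      unfolding dG dF by (simp add: algebra_simps power2_eq_square)
    also have "\<dots> = 0" by (simp add: dX GF)
    finally show "d_phi3 (G + F + w * la\<^sup>2 * X\<^sup>2 * G - K) = 0" .
    show "at_phi0 (G + F + w * la\<^sup>2 * X\<^sup>2 * G - K) = 0"
      unfolding K_def by (simp add: at_simps)
  qed
  hence K: "G + F + w * la\<^sup>2 * X\<^sup>2 * G = K" by simp
  have dN: "d_phi3 N = K - 2 * E"
  proof -
    have "d_phi3 N = - (2 * la * D1 * e * (w * S)) + (w * la\<^sup>2 * D1\<^sup>2 * e - 2 * sh) * C"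
      unfolding N_def by (simp add: d_simps)
    hence "d_phi3 N - (K - 2 * E) =
        (2 * h - 1) * (w * la\<^sup>2 * D1\<^sup>2 * e - w * la\<^sup>2 * D1\<^sup>2 * e * C) + (2 * ch - (e + e'))"
      unfolding E_def K_def h_def[symmetric] by (simp add: algebra_simps power2_eq_square)
    thus ?thesis by (simp add: h ch)
  qed
  have dE: "2 * d_phi3 E = w * N"
  proof -
    have d: "d_phi3 E = (sh - h * w * la\<^sup>2 * D1\<^sup>2 * e) * (- (w * S)) + w * la * D1 * e * C"
      unfolding E_def h_def[symmetric] by (simp add: d_simps)
    have "2 * d_phi3 E - w * N = (2 * h - 1) * (w * la\<^sup>2 * D1\<^sup>2 * e * w * S)"
      unfolding d N_def by (simp add: algebra_simps power2_eq_square)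
    thus ?thesis by (simp add: h)
  qed
  \<comment> \<open>Both (2 lam X G, G) and (N, E) solve U' = K - 2 V, 2 V' = omega U. Their
    difference solves the homogeneous system with zero initial value, whence the coefficients -2 and
    omega / 2.\<close>
  have "2 * la * X * G - N = 0 \<and> G - E = 0"
  proof (rule d_phi3_system_unique[where a = "- 2" and b = "of_real om / 2"])
    have "d_phi3 (2 * la * X * G - N) = 2 * la * d_phi3 X * G + 2 * la * X * d_phi3 G - d_phi3 N"
      by (simp add: d_simps algebra_simps)
    also have "\<dots> = - 2 * (G - E) + G * (2 * la * d_phi3 X - (F * F - 1 - la\<^sup>2 * w * X\<^sup>2)) + F * (G * F - 1)"
      unfolding dN dG K[symmetric] by (simp add: algebra_simps power2_eq_square)
    also have "\<dots> = - 2 * (G - E)" by (simp add: dX GF)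
    finally show "d_phi3 (2 * la * X * G - N) = scal (- 2) * (G - E)" by (simp add: scal_simps)
    have "of_real om / 2 = (1 / 2) * (of_real om :: complex)" by simp
    hence b: "scal (of_real om / 2) = h * w" unfolding h_def w_def scal_simps(6)[symmetric] by simp
    have "d_phi3 (G - E) = d_phi3 G - d_phi3 E" by (simp add: d_phi3_simps)
    also have "\<dots> = h * w * (2 * la * X * G - N)
        + (1 - 2 * h) * (la * w * X * G - d_phi3 E) + h * (w * N - 2 * d_phi3 E)"
      unfolding dG by (simp add: algebra_simps)
    finally show "d_phi3 (G - E) = scal (of_real om / 2) * (2 * la * X * G - N)"
      unfolding b by (simp add: dE h)
    show "at_phi0 (2 * la * X * G - N) = 0" unfolding N_def by (simp add: at_simps)
    have "at_phi0 (G - E) = e - (ch + sh)"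
      unfolding E_def h_def[symmetric] by (simp add: at_simps)
    also have "\<dots> = (1 - 2 * h) * (e - ch - sh) - h * ((2 * ch - (e + e')) + (2 * sh - (e - e')))"
      by (simp add: algebra_simps)
    finally show "at_phi0 (G - E) = 0" by (simp add: h ch sh)
  qed
  hence XN: "2 * la * X * G = N" and GE: "G = E" by auto

  \<comment> \<open>Constant term 1 allows the use of \<open>d_phi3_ln3\<close> and, as lam is
    nonzero, makes 2 lam E invertible.\<close>
  have G0: "G $ 0 $ 0 $ 0 = 1"
  proof -
    have "G $ 0 $ 0 $ 0 = at_phi0 G $ 0 $ 0 $ 0" by (simp add: at_phi0_def)
    also have "\<dots> = 1" unfolding at0_exp e_def la_def exp3_D2 by (simp add: const3_nth)
    finally show ?thesis .
  qed
  have "(2 * la * E) $ 0 $ 0 $ 0 \<noteq> 0"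
    using lam G0 unfolding GE[symmetric] la_def scal_simps(8)[symmetric] scal_simps(6)[symmetric] scal_mult_nth
    by simp
  from series3_inverse[OF this] show "flow lam om ?P1 = N * inverse (2 * la * E)"
    unfolding X_def[symmetric] XN[symmetric] GE by (simp add: mult.assoc mult.left_commute)

  have "la * Y - ln3 G = 0"
  proof (rule d_phi3_eq_0_imp)
    have "d_phi3 (la * Y - ln3 G) = la * d_phi3 Y - d_phi3 (ln3 G)"
      by (simp add: d_simps)
    \<comment> \<open>Division by G is replaced by multiplication by F; both terms vanish by
      \<open>GF\<close>, \<open>dG\<close> and \<open>d_phi3_ln3\<close>.\<close>
    also have "\<dots> = (la * w * X - d_phi3 (ln3 G)) * (1 - G * F) - (d_phi3 (ln3 G) * G - la * w * X * G) * F"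
      unfolding dY by (simp add: algebra_simps)
    also have "\<dots> = 0" by (simp add: d_phi3_ln3[OF G0] dG GF)
    finally show "d_phi3 (la * Y - ln3 G) = 0" .
    \<comment> \<open>At phi = 0 the series G is exp(lam D2), whose logarithm is lam D2.\<close>
    have "at_phi0 (ln3 G) = subst3 (fps_ln 1) (e - 1)"
      unfolding ln3_def at_phi0_subst3 by (simp add: at_phi0_simps at0_exp)
    also have "\<dots> = la * D2"
      unfolding e_def la_def exp3_D2
      unfolding const3_1[symmetric] const3_diff[symmetric] subst3_const3 fps_ln_compose_exp scal_D2 ..
    finally show "at_phi0 (la * Y - ln3 G) = 0" by (simp add: at_simps)
  qed
  hence "scal (1 / of_real lam) * ln3 E = scal (1 / of_real lam) * la * Y"
    unfolding GE by (simp add: mult.assoc)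
  also have "scal (1 / of_real lam) * la = 1"
    using lam unfolding la_def scal_simps(6)[symmetric] by (simp add: scal_simps)
  finally show "flow lam om ?P2 = scal (1 / of_real lam) * ln3 E" by (simp add: Y_def)
qed


section \<open>The action of the three generators\<close>

theorem mainTheorem2:
  fixes lam om :: real
    and H :: "('h, 'm) ring_scheme"
    and J :: 'h
    and emb :: "(real \<times> real \<Rightarrow> complex) \<Rightarrow> 'h"
    and f :: F
  assumes "lam \<noteq> 0"
    and "U_iso2 H lam om J emb"
  shows "let la = scal (of_real lam); w = scal (of_real om);
           C = subst3 (C_om om) Phi; S = subst3 (S_om om) Phi;
           P1 = emb (\<lambda>p. of_real (fst p)); P2 = emb (\<lambda>p. of_real (snd p))
         in
      right_regular H lam J emb f J = d_phi f \<and>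
      right_regular H lam J emb f P1 =
        act ((2 * la * D1 * exp3 (la * D2) * C
               + (w * la^2 * D1^2 * exp3 (la * D2) - 2 * sinh3 (la * D2)) * S)
             * inverse (2 * la * cosh3 (la * D2) + w * la^3 * D1^2 * exp3 (la * D2)
               + (2 * la * sinh3 (la * D2) - w * la^3 * D1^2 * exp3 (la * D2)) * C
               + 2 * w * la^2 * D1 * exp3 (la * D2) * S)) f \<and>
      right_regular H lam J emb f P2 =
        act (scal (1 / of_real lam)
             * ln3 (cosh3 (la * D2) + scal (1 / 2) * w * la^2 * D1^2 * exp3 (la * D2)
               + (sinh3 (la * D2) - scal (1 / 2) * w * la^2 * D1^2 * exp3 (la * D2)) * C
               + w * la * D1 * exp3 (la * D2) * S)) f"
proof -
  interpret U_iso2 H lam om J emb by fact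
  \<comment> \<open>The stated denominator is 2 lam times the bracket under the logarithm; the
    halves cancel by 2 h = 1.\<close>
  have "2 * la * (ch + h * w * la^2 * D1^2 * e + (sh - h * w * la^2 * D1^2 * e) * C
        + w * la * D1 * e * S) =
      2 * la * ch + w * la^3 * D1^2 * e + (2 * la * sh - w * la^3 * D1^2 * e) * C
        + 2 * w * la^2 * D1 * e * S"
    if "2 * h = 1" for la ch h w e sh C S :: series3
  proof -
    have "2 * la * (ch + h * w * la^2 * D1^2 * e + (sh - h * w * la^2 * D1^2 * e) * C
        + w * la * D1 * e * S) =
      2 * la * ch + (2 * h) * w * la^3 * D1^2 * e + (2 * la * sh - (2 * h) * w * la^3 * D1^2 * e) * C
        + 2 * w * la^2 * D1 * e * S"
      by (simp add: algebra_simps power2_eq_square power3_eq_cube)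
    thus ?thesis by (simp add: that)
  qed
  from this[OF scal_half] show ?thesis
    unfolding Let_def right_regular_J right_regular_emb[OF Lset.P1] right_regular_emb[OF Lset.P2]
      flow_generators[OF assms(1)] by simp
qed

end
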